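(* Fix $r\ge1$ and indeterminates $x=(x_0,\dots,x_r)$. For integers $n,k\ge0$ let $g_n^{(k)}\in\mathbb{Z}[x_0,\dots,x_r]$ be the sum of the weights of all two-stack-sortable $k$-tuple $r$-permutations of $[n]$ all of whose $k$ components are nonempty (so $g_0^{(k)}=\delta_{0k}$). Let $g_k=\sum_{n\ge0}g_n^{(k)}\in\mathbb{Q}[[x_0,\dots,x_r]]$, $G=\sum_{k\ge0}g_kz^k$, and define $f_k=\sum_{j\ge0}g_{k+j}e_j(x)$ for $k\ge0$ and $F=\sum_{k\ge0}f_kz^k$. Then $$G=1+zFG.$$ Moreover, $G$ (and hence $F$) is the unique power series $G=\sum_k g_kz^k$ with coefficients $g_k\in\mathbb{Q}[[x_0,\dots,x_r]]$ satisfying $G=1+zFG$ where $F=\sum_k z^k\sum_{j\ge0}g_{k+j}e_j(x)$.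
   Context: An $r$-permutation of a finite set $A$ of positive integers is a word in which each element of $A$ appears exactly $r$ times such that whenever $i<j<k$ and $a_i=a_k$ we have $a_j\le a_i$. A $k$-tuple $r$-permutation of $[n]$ is a tuple $(\alpha_1,\dots,\alpha_k)$ of words such that the concatenation $\alpha_1\cdots\alpha_k$ is an $r$-permutation of $[n]$ and every letter appears in only one $\alpha_i$ (each $\alpha_i$ is then an $r$-permutation of its letter set). Stack sorting $S$: on words with distinct letters, $S(\emptyset)=\emptyset$ and $S(\pi_l m\pi_r)=S(\pi_l)S(\pi_r)m$ where $m$ is the largest letter; on a nonempty $r$-permutation with largest letter $m$, written $\alpha_1m\alpha_2m\cdots m\alpha_{r+1}$, $S(\pi)=S(\alpha_1)\cdots S(\alpha_{r+1})m$. The tuple is two-stack-sortable if $S(S(\alpha_1)S(\alpha_2)\cdots S(\alpha_k))$ is the identity $12\cdots n$. Descents of an $r$-permutation: a letter $a$ is a type $i$ descent ($1\le i\le r$) if its $i$th occurrence is immediately followed by a smaller letter, and a type $0$ descent if its first occurrence immediately follows a smaller letter. The set of type $i$ descents of a $k$-tuple is the union of those of its components, and the weight of the tuple is $\prod_{i=0}^r x_i^{(\text{number of type } i\text{ descents})}$. $e_j(x)$ is the $j$th elementary symmetric polynomial in $x_0,\dots,x_r$ (zero for $j>r+1$). *)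

theory Defs
  imports "HOL-Library.Poly_Mapping" "HOL-Computational_Algebra.Formal_Power_Series"
begin

section \<open>Formal power series in the variables x_0, x_1, x_2, \<dots>\<close>

text \<open>
  A monomial is a finitely supported exponent function, of type \<open>nat \<Rightarrow>\<^sub>0 nat\<close>; a power series is
  an arbitrary family of coefficients indexed by monomials.  The ring of power series in
  \<open>x_0, \<dots>, x_r\<close> is the subset \<open>series_in_vars {..r}\<close> below.
\<close>

typedef 'a mseries = "UNIV :: ((nat \<Rightarrow>\<^sub>0 nat) \<Rightarrow> 'a) set"
  morphisms mcoeff Abs_mseries
  by simp

lemma mcoeff_Abs [simp]: "mcoeff (Abs_mseries f) = f"
  by (simp add: Abs_mseries_inverse)

lemma mseries_eqI: "(\<And>m. mcoeff f m = mcoeff g m) \<Longrightarrow> f = g"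
  by (metis ext mcoeff_inject)

definition splittings :: "(nat \<Rightarrow>\<^sub>0 nat) \<Rightarrow> ((nat \<Rightarrow>\<^sub>0 nat) \<times> (nat \<Rightarrow>\<^sub>0 nat)) set" where
  "splittings m = {(a, b). a + b = m}"

lemma finite_splittings [simp]: "finite (splittings m)"
proof -
  let ?B = "{f. \<forall>i. (i \<in> Poly_Mapping.keys m \<longrightarrow> f i \<in> {..Max (range (Poly_Mapping.lookup m))}) \<and>
                  (i \<notin> Poly_Mapping.keys m \<longrightarrow> f i = (0::nat))}"
  let ?A = "{a. \<exists>b. a + b = m}"
  have fr: "finite (range (Poly_Mapping.lookup m))"
  proof -
    have "range (Poly_Mapping.lookup m) \<subseteq> insert 0 (Poly_Mapping.lookup m ` Poly_Mapping.keys m)"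
      by (auto simp: in_keys_iff)
    thus ?thesis by (rule finite_subset) simp
  qed
  have "Poly_Mapping.lookup ` ?A \<subseteq> ?B"
  proof clarify
    fix a b i assume m: "m = a + b"
    have le: "Poly_Mapping.lookup a i \<le> Poly_Mapping.lookup m i"
      by (simp add: m lookup_add)
    also have "\<dots> \<le> Max (range (Poly_Mapping.lookup m))"
      using fr by simp
    finally show "(i \<in> Poly_Mapping.keys (a + b) \<longrightarrow>
            Poly_Mapping.lookup a i \<in> {..Max (range (Poly_Mapping.lookup (a + b)))}) \<and>
         (i \<notin> Poly_Mapping.keys (a + b) \<longrightarrow> Poly_Mapping.lookup a i = 0)"
      using le by (auto simp: m in_keys_iff)
  qed
  moreover have "finite ?B"
    by (rule finite_set_of_finite_funs) auto
  ultimately have "finite (Poly_Mapping.lookup ` ?A)"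
    by (rule finite_subset)
  hence fA: "finite ?A"
    by (rule finite_imageD) (simp add: inj_on_def poly_mapping_eqI)
  have "splittings m \<subseteq> (\<lambda>a. (a, m - a)) ` ?A"
    by (auto simp: splittings_def)
  thus ?thesis using fA finite_surj by blast
qed

instantiation mseries :: (comm_ring_1) comm_ring_1
begin

definition "0 = Abs_mseries (\<lambda>_. 0)"
definition "1 = Abs_mseries (\<lambda>m. if m = 0 then 1 else 0)"
definition "f + g = Abs_mseries (\<lambda>m. mcoeff f m + mcoeff g m)"
definition "f - g = Abs_mseries (\<lambda>m. mcoeff f m - mcoeff g m)"
definition "- f = Abs_mseries (\<lambda>m. - mcoeff f m)"
definition "f * g = Abs_mseries (\<lambda>m. \<Sum>(a, b)\<in>splittings m. mcoeff f a * mcoeff g b)"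

instance
proof
  fix f g h :: "'a mseries"
  show "f * g * h = f * (g * h)"
  proof (rule mseries_eqI)
    fix m
    have "mcoeff (f * g * h) m =
        (\<Sum>(p, c)\<in>splittings m. \<Sum>(a, b)\<in>splittings p. mcoeff f a * mcoeff g b * mcoeff h c)"
      by (simp add: times_mseries_def sum_distrib_right case_prod_unfold)
    also have "\<dots> = (\<Sum>((p, c), (a, b))\<in>(SIGMA x:splittings m. splittings (fst x)).
                     mcoeff f a * mcoeff g b * mcoeff h c)"
      unfolding case_prod_unfold by (subst sum.Sigma) (auto simp: case_prod_unfold)
    also have "\<dots> = (\<Sum>((a, q), (b, c))\<in>(SIGMA x:splittings m. splittings (snd x)).
                     mcoeff f a * mcoeff g b * mcoeff h c)"
      by (rule sum.reindex_bij_witness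
            [where i = "\<lambda>((a, q), (b, c)). ((a + b, c), (a, b))"
               and j = "\<lambda>((p, c), (a, b)). ((a, b + c), (b, c))"])
         (auto simp: splittings_def add.assoc)
    also have "\<dots> = (\<Sum>(a, q)\<in>splittings m. \<Sum>(b, c)\<in>splittings q. mcoeff f a * mcoeff g b * mcoeff h c)"
      unfolding case_prod_unfold by (subst sum.Sigma) (auto simp: case_prod_unfold)
    also have "\<dots> = mcoeff (f * (g * h)) m"
      by (simp add: times_mseries_def sum_distrib_left case_prod_unfold mult.assoc)
    finally show "mcoeff (f * g * h) m = mcoeff (f * (g * h)) m" .
  qed
  show "f * g = g * f"
  proof (rule mseries_eqI)
    fix m
    show "mcoeff (f * g) m = mcoeff (g * f) m"
      unfolding times_mseries_def mcoeff_Abs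
      by (rule sum.reindex_bij_witness[where i = prod.swap and j = prod.swap])
         (auto simp: splittings_def add.commute mult.commute)
  qed
  show "1 * f = f"
  proof (rule mseries_eqI)
    fix m
    have "mcoeff (1 * f) m = (\<Sum>(a, b)\<in>splittings m. if a = 0 then mcoeff f b else 0)"
      by (auto simp: times_mseries_def one_mseries_def intro!: sum.cong)
    also have "\<dots> = (\<Sum>(a, b)\<in>{(0 :: nat \<Rightarrow>\<^sub>0 nat, m)}. if a = 0 then mcoeff f b else 0)"
      by (rule sum.mono_neutral_right[OF finite_splittings]) (auto simp: splittings_def split: if_splits)
    finally show "mcoeff (1 * f) m = mcoeff f m" by simp
  qed
  show "(f + g) * h = f * h + g * h"
    by (rule mseries_eqI)
       (simp add: times_mseries_def plus_mseries_def ring_distribs case_prod_unfold sum.distrib)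
  show "(0::'a mseries) \<noteq> 1"
  proof
    assume "(0::'a mseries) = 1"
    hence "mcoeff (0::'a mseries) 0 = mcoeff 1 0" by (rule arg_cong)
    thus False by (simp add: zero_mseries_def one_mseries_def)
  qed
  show "f + g + h = f + (g + h)" "f + g = g + f" "0 + f = f" "- f + f = 0" "f - g = f + - g"
    by (rule mseries_eqI; simp add: plus_mseries_def minus_mseries_def uminus_mseries_def
          zero_mseries_def add.assoc add.commute[of "mcoeff f _"])+
qed

end

definition series_in_vars :: "nat set \<Rightarrow> 'a::zero mseries set" where
  "series_in_vars V = {f. \<forall>m. mcoeff f m \<noteq> 0 \<longrightarrow> Poly_Mapping.keys m \<subseteq> V}"

type_synonym int_mpoly = "(nat \<Rightarrow>\<^sub>0 nat) \<Rightarrow>\<^sub>0 int"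

definition mvar :: "nat \<Rightarrow> int_mpoly" where
  "mvar i = Poly_Mapping.single (Poly_Mapping.single i 1) 1"

definition elem_sym :: "nat \<Rightarrow> nat \<Rightarrow> int_mpoly" where
  "elem_sym r j = (\<Sum>A | A \<subseteq> {..r} \<and> card A = j. \<Prod>i\<in>A. mvar i)"

definition series_of_poly :: "int_mpoly \<Rightarrow> rat mseries" where
  "series_of_poly p = Abs_mseries (\<lambda>m. of_int (Poly_Mapping.lookup p m))"

text \<open>
  A sequence of power series is summable if each coefficient receives only finitely many nonzero
  contributions; its sum is then taken coefficientwise.  (\<open>Sum_any\<close> sums over the support,
  and is \<open>0\<close> by convention if the support is infinite.)
\<close>

definition mseries_summable :: "(nat \<Rightarrow> 'a::comm_monoid_add mseries) \<Rightarrow> bool" where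
  "mseries_summable u \<longleftrightarrow> (\<forall>m. finite {n. mcoeff (u n) m \<noteq> 0})"

definition mseries_suminf :: "(nat \<Rightarrow> 'a::comm_monoid_add mseries) \<Rightarrow> 'a mseries" where
  "mseries_suminf u = Abs_mseries (\<lambda>m. Sum_any (\<lambda>n. mcoeff (u n) m))"


section \<open>Permutations with repeated letters and stack sorting\<close>

definition r_permutation :: "nat \<Rightarrow> nat set \<Rightarrow> nat list \<Rightarrow> bool" where
  "r_permutation r A w \<longleftrightarrow>
     set w = A \<and> (\<forall>a\<in>A. count_list w a = r) \<and>
     (\<forall>i j k. i < j \<and> j < k \<and> k < length w \<and> w ! i = w ! k \<longrightarrow> w ! j \<le> w ! i)"

definition tuple_r_permutation :: "nat \<Rightarrow> nat \<Rightarrow> nat \<Rightarrow> nat list list \<Rightarrow> bool" where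
  "tuple_r_permutation r n k \<alpha> \<longleftrightarrow>
     length \<alpha> = k \<and> r_permutation r {1..n} (concat \<alpha>) \<and>
     (\<forall>i<k. \<forall>j<k. i \<noteq> j \<longrightarrow> set (\<alpha> ! i) \<inter> set (\<alpha> ! j) = {})"

text \<open>\<open>split_at m (\<alpha>\<^sub>1 @ m # \<alpha>\<^sub>2 @ m # \<dots> @ m # \<alpha>\<^sub>s) = [\<alpha>\<^sub>1, \<dots>, \<alpha>\<^sub>s]\<close> if \<open>m\<close> occurs in none of the \<open>\<alpha>\<^sub>i\<close>.\<close>

fun split_at :: "'a \<Rightarrow> 'a list \<Rightarrow> 'a list list" where
  "split_at m [] = [[]]"
| "split_at m (y # ys) =
     (if y = m then [] # split_at m ys
      else (y # hd (split_at m ys)) # tl (split_at m ys))"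

lemma split_at_not_Nil [simp]: "split_at m w \<noteq> []"
  by (cases w) auto

lemma split_at_subset: "\<alpha> \<in> set (split_at m w) \<Longrightarrow> set \<alpha> \<subseteq> set w - {m}"
proof (induction w arbitrary: \<alpha>)
  case (Cons y ys)
  obtain p ps where sp: "split_at m ys = p # ps"
    using split_at_not_Nil by (metis list.exhaust)
  have "set p \<subseteq> set ys - {m}" "\<And>q. q \<in> set ps \<Longrightarrow> set q \<subseteq> set ys - {m}"
    by (rule Cons.IH, simp add: sp)+
  with Cons.prems show ?case by (fastforce simp: sp split: if_splits)
qed auto

text \<open>
  A single recursion covers both cases of the definition of the stack sorting map: on words with
  distinct letters the largest letter occurs once, on an \<open>r\<close>-permutation it occurs \<open>r\<close> times.
  See \<open>stack_sort_distinct\<close> and \<open>stack_sort_pieces\<close>.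
\<close>

function stack_sort :: "nat list \<Rightarrow> nat list" where
  "stack_sort w =
     (if w = [] then []
      else concat (map stack_sort (split_at (Max (set w)) w)) @ [Max (set w)])"
  by auto
termination
proof (relation "measure (\<lambda>w. card (set w))", goal_cases)
  case (2 w \<alpha>)
  hence "set \<alpha> \<subset> set w"
    using split_at_subset[of \<alpha> "Max (set w)" w] Max_in[of "set w"] by auto
  thus ?case by (simp add: psubset_card_mono)
qed simp

declare stack_sort.simps [simp del]

lemma stack_sort_Nil [simp]: "stack_sort [] = []"
  by (simp add: stack_sort.simps)

lemma split_at_append:
  "m \<notin> set u \<Longrightarrow> split_at m (u @ m # v) = u # split_at m v"
  by (induction u) auto

lemma split_at_notin: "m \<notin> set u \<Longrightarrow> split_at m u = [u]"
  by (induction u) auto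

lemma stack_sort_distinct:
  assumes "\<forall>a\<in>set l \<union> set u. a < m"
  shows "stack_sort (l @ m # u) = stack_sort l @ stack_sort u @ [m]"
proof -
  have m: "Max (set (l @ m # u)) = m"
    using assms by (intro Max_eqI) (auto intro: less_imp_le)
  have "m \<notin> set l" "m \<notin> set u" using assms by auto
  hence sp: "split_at m (l @ m # u) = [l, u]"
    by (simp add: split_at_append split_at_notin)
  show ?thesis
    using stack_sort.simps[of "l @ m # u"] unfolding m sp by simp
qed

lemma stack_sort_pieces:
  assumes "\<forall>\<alpha>\<in>set (\<alpha>s @ [\<beta>]). \<forall>a\<in>set \<alpha>. a < m" "\<alpha>s \<noteq> []"
  shows "stack_sort (concat (map (\<lambda>\<alpha>. \<alpha> @ [m]) \<alpha>s) @ \<beta>) =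
         concat (map stack_sort (\<alpha>s @ [\<beta>])) @ [m]"
proof -
  let ?w = "concat (map (\<lambda>\<alpha>. \<alpha> @ [m]) \<alpha>s) @ \<beta>"
  have in_w: "m \<in> set ?w" using assms(2) by (cases \<alpha>s) auto
  have le: "a \<le> m" if "a \<in> set ?w" for a
    using that assms(1) by (auto intro: less_imp_le split: if_splits)
  have m: "Max (set ?w) = m"
    using le in_w by (intro Max_eqI) simp_all
  have ne: "?w \<noteq> []"
    using in_w by force
  have "m \<notin> set \<beta>" "\<forall>\<alpha>\<in>set \<alpha>s. m \<notin> set \<alpha>" using assms(1) by auto
  hence sp: "split_at m ?w = \<alpha>s @ [\<beta>]"
    by (induction \<alpha>s) (auto simp: split_at_append split_at_notin)
  show ?thesis
    using stack_sort.simps[of ?w] unfolding m sp if_not_P[OF ne] .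
qed

definition two_stack_sortable :: "nat \<Rightarrow> nat list list \<Rightarrow> bool" where
  "two_stack_sortable n \<alpha> \<longleftrightarrow> stack_sort (concat (map stack_sort \<alpha>)) = [1..<n + 1]"


section \<open>Descents and weights\<close>

text \<open>\<open>occurrence w i a p\<close>: the \<open>i\<close>th occurrence (\<open>i \<ge> 1\<close>) of \<open>a\<close> in \<open>w\<close> is at position \<open>p\<close>.\<close>

definition occurrence :: "nat list \<Rightarrow> nat \<Rightarrow> nat \<Rightarrow> nat \<Rightarrow> bool" where
  "occurrence w i a p \<longleftrightarrow> p < length w \<and> w ! p = a \<and> count_list (take (p + 1) w) a = i"

definition descents :: "nat \<Rightarrow> nat list \<Rightarrow> nat set" where
  "descents i w =
     (if i = 0 then {a. \<exists>p. occurrence w 1 a (p + 1) \<and> w ! p < a}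
      else {a. \<exists>p. occurrence w i a p \<and> p + 1 < length w \<and> w ! (p + 1) < a})"

definition tuple_descents :: "nat \<Rightarrow> nat list list \<Rightarrow> nat set" where
  "tuple_descents i \<alpha> = (\<Union>w\<in>set \<alpha>. descents i w)"

definition weight :: "nat \<Rightarrow> nat list list \<Rightarrow> int_mpoly" where
  "weight r \<alpha> = (\<Prod>i\<le>r. mvar i ^ card (tuple_descents i \<alpha>))"


section \<open>The generating functions\<close>

definition sortable_tuples :: "nat \<Rightarrow> nat \<Rightarrow> nat \<Rightarrow> nat list list set" where
  "sortable_tuples r n k =
     {\<alpha>. tuple_r_permutation r n k \<alpha> \<and> (\<forall>w\<in>set \<alpha>. w \<noteq> []) \<and> two_stack_sortable n \<alpha>}"

lemma finite_sortable_tuples: "finite (sortable_tuples r n k)"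
proof -
  have "sortable_tuples r n k \<subseteq>
        {\<alpha>. set \<alpha> \<subseteq> {w. set w \<subseteq> {1..n} \<and> length w \<le> n * r} \<and> length \<alpha> = k}"
  proof
    fix \<alpha> assume a: "\<alpha> \<in> sortable_tuples r n k"
    hence *: "set (concat \<alpha>) = {1..n}" "\<forall>a\<in>{1..n}. count_list (concat \<alpha>) a = r" "length \<alpha> = k"
      by (auto simp: sortable_tuples_def tuple_r_permutation_def r_permutation_def)
    have "length (concat \<alpha>) = (\<Sum>a\<in>{1..n}. count_list (concat \<alpha>) a)"
      using *(1) by (metis sum_count_set finite_set subset_refl)
    also have "\<dots> = n * r" using *(2) by simp
    finally have len: "length (concat \<alpha>) = n * r" .
    have "length w \<le> length (concat \<alpha>)" if "w \<in> set \<alpha>" for w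
      using that by (auto simp: length_concat intro!: member_le_sum_list)
    with len *(1,3)
    show "\<alpha> \<in> {\<alpha>. set \<alpha> \<subseteq> {w. set w \<subseteq> {1..n} \<and> length w \<le> n * r} \<and> length \<alpha> = k}"
      by fastforce
  qed
  moreover have "finite {w. set w \<subseteq> {1..n} \<and> length w \<le> n * r}"
    by (rule finite_lists_length_le) simp
  ultimately show ?thesis
    using finite_lists_length_eq finite_subset by blast
qed

definition g_poly :: "nat \<Rightarrow> nat \<Rightarrow> nat \<Rightarrow> int_mpoly" where
  "g_poly r n k = (\<Sum>\<alpha>\<in>sortable_tuples r n k. weight r \<alpha>)"

definition g_series :: "nat \<Rightarrow> nat \<Rightarrow> rat mseries" where
  "g_series r k = mseries_suminf (\<lambda>n. series_of_poly (g_poly r n k))"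

definition G_series :: "nat \<Rightarrow> rat mseries fps" where
  "G_series r = Abs_fps (g_series r)"

text \<open>
  The series F associated with an arbitrary G.  The sum over all \<open>j\<close> stops at \<open>r + 1\<close>, because
  \<open>elem_sym r j = 0\<close> for \<open>j > r + 1\<close>.
\<close>

definition F_of :: "nat \<Rightarrow> rat mseries fps \<Rightarrow> rat mseries fps" where
  "F_of r G = Abs_fps (\<lambda>k. \<Sum>j\<le>r + 1. fps_nth G (k + j) * series_of_poly (elem_sym r j))"

lemma elem_sym_eq_0:
  assumes "j > r + 1"
  shows "elem_sym r j = 0"
proof -
  have "card A \<noteq> j" if "A \<subseteq> {..r}" for A
    using card_mono[OF finite_atMost that] assms by simp
  hence "{A. A \<subseteq> {..r} \<and> card A = j} = {}"
    by blast
  thus ?thesis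
    unfolding elem_sym_def by (simp only: sum.empty)
qed

end

theory Submission
  imports Defs "HOL-Library.Sublist"
begin

text \<open>
  Remove the largest letter \<open>n\<close> from a two-stack-sortable \<open>k\<close>-tuple, \<open>k \<ge> 1\<close>. If \<open>n\<close> lies in the component
  \<open>i + 1\<close>, it separates this component into \<open>r + 1\<close> words, of which the nonempty ones are indexed by a
  set \<open>A\<close> with \<open>j\<close> elements, and \<open>n\<close> is a type \<open>a\<close> descent exactly for \<open>a \<in> A\<close>. The output of the first pass
  is \<open>L n R\<close>, where \<open>L\<close> comes from the first \<open>i\<close> components together with the \<open>j\<close> nonempty words, and \<open>R\<close>
  from the last \<open>k - 1 - i\<close> components. The second pass turns it into \<open>S(L) S(R) n\<close>, so for some \<open>p\<close> the first
  part is a sortable \<open>(i + j)\<close>-tuple on \<open>1, \<dots>, p\<close> and the second one a shifted sortable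
  \<open>(k - 1 - i)\<close>-tuple. Summing the weights over \<open>A\<close> gives \<open>e\<^sub>j\<close>, hence the recursion equivalent to
  \<open>G = 1 + zFG\<close>. It also shows that \<open>g_n^(k)\<close> is homogeneous of degree \<open>n - k\<close>, which gives
  summability, and its solution is unique by induction on the sum of \<open>k\<close> and the degree.
\<close>

section \<open>Nested words and stack sorting\<close>

text \<open>The condition on equal letters forbids the pattern a b a with a < b. Stated with
  subsequences, it splits over concatenations without index arithmetic.\<close>

definition nested :: "nat list \<Rightarrow> bool" where
  "nested w \<longleftrightarrow> (\<forall>a b. a < b \<longrightarrow> \<not> subseq [a, b, a] w)"

lemma subseq_3_iff:
  "subseq [a, b, c] w \<longleftrightarrow> (\<exists>i j k. i < j \<and> j < k \<and> k < length w \<and> w ! i = a \<and> w ! j = b \<and> w ! k = c)"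
proof
  assume "subseq [a, b, c] w"
  then obtain us vs where 1: "w = us @ a # vs" "subseq [b, c] vs"
    by (blast dest: list_emb_ConsD)
  then obtain us' vs' where 2: "vs = us' @ b # vs'" "subseq [c] vs'"
    by (blast dest: list_emb_ConsD)
  then obtain us'' vs'' where 3: "vs' = us'' @ c # vs''"
    by (blast dest: list_emb_ConsD)
  have "w ! length us = a" "w ! (length us + 1 + length us') = b"
    "w ! (length us + 1 + length us' + 1 + length us'') = c"
    using 1 2 3 by (auto simp: nth_append)
  moreover have "length us + 1 + length us' + 1 + length us'' < length w"
    using 1 2 3 by auto
  ultimately show "\<exists>i j k. i < j \<and> j < k \<and> k < length w \<and> w ! i = a \<and> w ! j = b \<and> w ! k = c"
    by (intro exI[of _ "length us"] exI[of _ "length us + 1 + length us'"]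
        exI[of _ "length us + 1 + length us' + 1 + length us''"]) simp
next
  assume "\<exists>i j k. i < j \<and> j < k \<and> k < length w \<and> w ! i = a \<and> w ! j = b \<and> w ! k = c"
  then obtain i j k where *: "i < j" "j < k" "k < length w" "w ! i = a" "w ! j = b" "w ! k = c"
    by blast
  define u where "u = drop (Suc i) w"
  define v where "v = drop (Suc j) w"
  have w: "take i w @ a # u = w"
    using * id_take_nth_drop[of i w] by (simp add: u_def)
  have u: "take (j - Suc i) u @ b # v = u"
    using * id_take_nth_drop[of "j - Suc i" u] by (simp add: u_def v_def)
  have "v ! (k - Suc j) = c" "k - Suc j < length v"
    using * by (simp_all add: v_def)
  then have "c \<in> set v"
    by (metis nth_mem)
  then have "subseq [b, c] (b # v)"
    by (simp add: subseq_singleton_left)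
  from list_emb_append2[OF this, of "take (j - Suc i) u"] have "subseq [a, b, c] (a # u)"
    by (simp add: u)
  from list_emb_append2[OF this, of "take i w"] show "subseq [a, b, c] w"
    by (simp add: w)
qed

lemma nested_iff_nth:
  "nested w \<longleftrightarrow>
     (\<forall>i j k. i < j \<and> j < k \<and> k < length w \<and> w ! i = w ! k \<longrightarrow> w ! j \<le> w ! i)"
  unfolding nested_def subseq_3_iff by (metis not_le)

lemma nested_Nil [simp]: "nested []"
  by (simp add: nested_def)

lemma subseq_3_append:
  "subseq [a, b, c] (u @ v) \<longleftrightarrow>
     subseq [a, b, c] u \<or> subseq [a, b] u \<and> c \<in> set v \<or> a \<in> set u \<and> subseq [b, c] v \<or> subseq [a, b, c] v"
proof
  assume "subseq [a, b, c] (u @ v)"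
  then obtain xs ys where *: "[a, b, c] = xs @ ys" "subseq xs u" "subseq ys v"
    by (metis subseq_append_iff)
  show "subseq [a, b, c] u \<or> subseq [a, b] u \<and> c \<in> set v \<or> a \<in> set u \<and> subseq [b, c] v \<or> subseq [a, b, c] v"
    using * by (auto simp: Cons_eq_append_conv subseq_singleton_left)
next
  assume "subseq [a, b, c] u \<or> subseq [a, b] u \<and> c \<in> set v \<or> a \<in> set u \<and> subseq [b, c] v \<or> subseq [a, b, c] v"
  thus "subseq [a, b, c] (u @ v)"
    using list_emb_append_mono[of "(=)" "[a, b]" u "[c]" v] list_emb_append_mono[of "(=)" "[a]" u "[b, c]" v]
      list_emb_append_mono[of "(=)" "[a, b, c]" u "[]" v] list_emb_append2[of "(=)" "[a, b, c]" v u]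
    by (simp add: subseq_singleton_left) blast
qed

text \<open>A forbidden a b a takes both copies of a from the same word, and hence b as
  well.\<close>

lemma nested_append:
  assumes "set u \<inter> set v = {}"
  shows "nested (u @ v) \<longleftrightarrow> nested u \<and> nested v"
proof -
  have *: "a \<in> set u" if "subseq [a, b] u" for a b
    using list_emb_set[OF that, of a] by auto
  have **: "a \<in> set v" if "subseq [b, a] v" for a b
    using list_emb_set[OF that, of a] by auto
  show ?thesis
    unfolding nested_def subseq_3_append using assms by (blast dest: * **)
qed

text \<open>A letter a on both sides gives the pattern a m a. Otherwise both copies of a in a
  forbidden a b a lie on the same side of \<open>m\<close>, as a < b \<le> m excludes a = m. The
  weak bound on \<open>v\<close> admits further copies of \<open>m\<close> there.\<close>

lemma nested_insert_max:
  assumes "\<forall>a\<in>set u. a < m" "\<forall>a\<in>set v. a \<le> m"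
  shows "nested (u @ m # v) \<longleftrightarrow> nested u \<and> nested v \<and> set u \<inter> set v = {}"
proof -
  have u: "a \<in> set u" if "subseq [a, b] u" for a b
    using list_emb_set[OF that, of a] by auto
  have mv: "a \<in> set v" if "subseq [b, a] (m # v)" "a \<noteq> m" for a b
    using list_emb_set[OF that(1), of a] that(2) by auto
  have le: "b \<le> m" if "subseq [a, b, c] (m # v)" for a b c
    using list_emb_set[OF that, of b] assms(2) by auto
  have "\<not> nested (u @ m # v)" if "a \<in> set u" "a \<in> set v" for a
  proof -
    have "a < m" "subseq [a, m, a] (u @ m # v)"
      using that assms(1) by (auto simp: subseq_3_append subseq_singleton_left)
    thus ?thesis unfolding nested_def by blast
  qed
  moreover have "nested u \<and> nested v" if "nested (u @ m # v)"
    using that unfolding nested_def subseq_3_append by (blast intro: list_emb_Cons)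
  moreover have "nested (u @ m # v)" if n: "nested u" "nested v" and d: "set u \<inter> set v = {}"
    unfolding nested_def
  proof (intro allI impI notI)
    fix a b assume "a < b" "subseq [a, b, a] (u @ m # v)"
    then consider "subseq [a, b, a] u" | "a \<in> set u" "subseq [b, a] (m # v) \<or> a \<in> set (m # v)"
      | "subseq [a, b, a] (m # v)"
      unfolding subseq_3_append by (blast dest: u)
    then show False
    proof cases
      case 1
      with n(1) \<open>a < b\<close> show False by (auto simp: nested_def)
    next
      case 2
      then have "a \<noteq> m" using assms(1) by auto
      with 2(2) have "a \<in> set v" using mv by auto
      with 2(1) d show False by blast
    next
      case 3
      with le[OF 3] \<open>a < b\<close> have "subseq [a, b, a] v" by simp
      with n(2) \<open>a < b\<close> show False by (auto simp: nested_def)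
    qed
  qed
  ultimately show ?thesis by blast
qed

section \<open>Cutting a word at a letter and joining the pieces again\<close>

fun join :: "'a \<Rightarrow> 'a list list \<Rightarrow> 'a list" where
  "join m [] = []"
| "join m [s] = s"
| "join m (s # t # ss) = s @ m # join m (t # ss)"

text \<open>Every \<open>m\<close> in the joined word is a separator. With r + 1 entries below
  \<open>m\<close>, the joined word is the form a_1 m a_2 m ... m a_(r+1) of a component with
  largest letter \<open>m\<close>. The case \<open>ss = []\<close> is excluded because
  \<open>join\<close> sends \<open>[]\<close> and \<open>[[]]\<close> to the same word.\<close>

lemma split_at_join:
  "ss \<noteq> [] \<Longrightarrow> m \<notin> set (concat ss) \<Longrightarrow> split_at m (join m ss) = ss"
  by (induction m ss rule: join.induct) (auto simp: split_at_append split_at_notin)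

lemma join_Cons: "join m (s # ss) = s @ (if ss = [] then [] else m # join m ss)"
  by (cases ss) auto

lemma join_split_at: "join m (split_at m w) = w"
proof (induction w)
  case (Cons y ys)
  then show ?case
    by (cases "split_at m ys") (auto simp: join_Cons)
qed auto

lemma length_split_at: "length (split_at m w) = Suc (count_list w m)"
  by (induction w) auto

lemma set_join: "set (join m ss) = set (concat ss) \<union> (if 2 \<le> length ss then {m} else {})"
  by (induction m ss rule: join.induct) auto

lemma count_list_join:
  "count_list (join m ss) a = count_list (concat ss) a + (if a = m then length ss - 1 else 0)"
  by (induction m ss rule: join.induct) auto

text \<open>The relation is symmetric, so \<open>sorted_wrt\<close> expresses pairwise disjointness
  in a form that suits list induction and appending. Empty words may be repeated.\<close>

abbreviation disjoint_letters :: "'a list list \<Rightarrow> bool" where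
  "disjoint_letters \<equiv> sorted_wrt (\<lambda>u v. set u \<inter> set v = {})"

lemma disjoint_letters_nth:
  "disjoint_letters \<alpha> \<longleftrightarrow>
     (\<forall>i<length \<alpha>. \<forall>j<length \<alpha>. i \<noteq> j \<longrightarrow> set (\<alpha> ! i) \<inter> set (\<alpha> ! j) = {})"
    (is "_ \<longleftrightarrow> ?R")
proof
  assume s: "disjoint_letters \<alpha>"
  show ?R
  proof (intro allI impI)
    fix i j assume "i < length \<alpha>" "j < length \<alpha>" "i \<noteq> j"
    then show "set (\<alpha> ! i) \<inter> set (\<alpha> ! j) = {}"
      using sorted_wrt_nth_less[OF s, of i j] sorted_wrt_nth_less[OF s, of j i] by (cases "i < j") auto
  qed
next
  assume ?R
  then show "disjoint_letters \<alpha>"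
    by (simp add: sorted_wrt_iff_nth_less)
qed

lemma nested_concat:
  "disjoint_letters \<alpha> \<Longrightarrow> nested (concat \<alpha>) \<longleftrightarrow> (\<forall>w\<in>set \<alpha>. nested w)"
proof (induction \<alpha>)
  case (Cons w \<alpha>)
  then have "set w \<inter> set (concat \<alpha>) = {}" by auto
  with Cons show ?case by (simp add: nested_append)
qed simp

lemma nested_join:
  "\<forall>a\<in>set (concat ss). a < m \<Longrightarrow>
     nested (join m ss) \<longleftrightarrow> disjoint_letters ss \<and> (\<forall>s\<in>set ss. nested s)"
proof (induction m ss rule: join.induct)
  case (3 m s t ss)
  let ?v = "join m (t # ss)"
  have "\<forall>a\<in>set ?v. a \<le> m"
    using 3(2) by (auto simp: set_join less_imp_le)
  moreover have "set s \<inter> set ?v = {} \<longleftrightarrow> set s \<inter> set (concat (t # ss)) = {}"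
    using 3(2) by (auto simp: set_join)
  ultimately show ?case
    using 3 by (auto simp: nested_insert_max)
qed auto

text \<open>Two entries guarantee that \<open>m\<close> occurs, so it is the maximum at which
  \<open>stack_sort\<close> cuts.\<close>

lemma stack_sort_join:
  assumes "\<forall>a\<in>set (concat ss). a < m" "2 \<le> length ss"
  shows "stack_sort (join m ss) = concat (map stack_sort ss) @ [m]"
proof -
  have "Max (set (join m ss)) = m"
    using assms by (intro Max_eqI) (auto simp: set_join less_imp_le)
  moreover have "split_at m (join m ss) = ss"
    using assms by (intro split_at_join) auto
  moreover have "join m ss \<noteq> []"
    using assms(2) set_join[of m ss] by fastforce
  ultimately show ?thesis
    by (simp add: stack_sort.simps[of "join m ss"])
qed

lemma set_stack_sort [simp]: "set (stack_sort w) = set w"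
proof (induction w rule: stack_sort.induct)
  case (1 w)
  show ?case
  proof (cases "w = []")
    case False
    let ?m = "Max (set w)"
    have "set (stack_sort w) = set (concat (split_at ?m w)) \<union> {?m}"
      using 1 False by (subst stack_sort.simps) auto
    also have "\<dots> = set w"
    proof
      show "set (concat (split_at ?m w)) \<union> {?m} \<subseteq> set w"
        using False split_at_subset[of _ ?m w] by fastforce
      show "set w \<subseteq> set (concat (split_at ?m w)) \<union> {?m}"
        using set_join[of ?m "split_at ?m w"] by (auto simp: join_split_at split: if_splits)
    qed
    finally show ?thesis .
  qed simp
qed

lemma split_at_map: "inj f \<Longrightarrow> split_at (f m) (map f w) = map (map f) (split_at m w)"
  by (induction w) (auto simp: inj_eq map_tl hd_map)

text \<open>A strictly increasing map commutes with the maximum and with the cut at it. This carries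
  the shift of 1, ..., n - p to p + 1, ..., n through both passes.\<close>

lemma stack_sort_map:
  assumes "strict_mono f"
  shows "stack_sort (map f w) = map f (stack_sort w)"
proof (induction w rule: stack_sort.induct)
  case (1 w)
  show ?case
  proof (cases "w = []")
    case False
    have M: "Max (set (map f w)) = f (Max (set w))"
      using mono_Max_commute[OF strict_mono_mono[OF assms], of "set w"] False by simp
    have "stack_sort (map f w) =
        concat (map stack_sort (map (map f) (split_at (Max (set w)) w))) @ [f (Max (set w))]"
      using False by (subst stack_sort.simps) (simp add: M split_at_map strict_mono_imp_inj_on[OF assms] del: set_map)
    also have "\<dots> = map f (stack_sort w)"
      using 1 False stack_sort.simps[of w] by (simp add: map_concat cong: map_cong)
    finally show ?thesis .
  qed simp
qed

section \<open>Sortable tuples and removal of the largest letter\<close>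

text \<open>Words between copies of the largest letter may be empty, whereas components of the
  counted tuples may not.\<close>

abbreviation nonempty :: "'a list list \<Rightarrow> 'a list list" where
  "nonempty \<equiv> filter (\<lambda>s. s \<noteq> [])"

lemma concat_map_nonempty: "f [] = [] \<Longrightarrow> concat (map f (nonempty ss)) = concat (map f ss)"
  by (induction ss) auto

lemma concat_nonempty [simp]: "concat (nonempty ss) = concat ss"
  by (induction ss) auto

lemma disjoint_letters_nonempty [simp]: "disjoint_letters (nonempty ss) = disjoint_letters ss"
  by (induction ss) auto

text \<open>The joined component has the letters of \<open>ss\<close> and possibly \<open>m\<close>,
  which the other components avoid. The conjunct \<open>disjoint_letters ss\<close> will come from
  the nestedness of the joined word.\<close>

lemma disjoint_letters_join:
  assumes "m \<notin> set (concat (xs @ ys))"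
  shows "disjoint_letters (xs @ join m ss # ys) \<and> disjoint_letters ss \<longleftrightarrow>
         disjoint_letters (xs @ nonempty ss @ ys)"
proof -
  have "set x \<inter> set (join m ss) = {} \<longleftrightarrow> (\<forall>s\<in>set (nonempty ss). set x \<inter> set s = {})"
    if "x \<in> set (xs @ ys)" for x
  proof -
    have "m \<notin> set x" using that assms by auto
    then show ?thesis by (auto simp: set_join)
  qed
  then have "(\<forall>x\<in>set xs. set x \<inter> set (join m ss) = {}) \<longleftrightarrow>
        (\<forall>x\<in>set xs. \<forall>s\<in>set (nonempty ss). set x \<inter> set s = {})"
    and "(\<forall>y\<in>set ys. set (join m ss) \<inter> set y = {}) \<longleftrightarrow>
        (\<forall>s\<in>set (nonempty ss). \<forall>y\<in>set ys. set s \<inter> set y = {})"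
    by (simp, simp add: Int_commute, blast)
  moreover have "(\<forall>x\<in>set xs. \<forall>y\<in>set (join m ss # ys). set x \<inter> set y = {}) \<longleftrightarrow>
        (\<forall>x\<in>set xs. set x \<inter> set (join m ss) = {}) \<and> (\<forall>x\<in>set xs. \<forall>y\<in>set ys. set x \<inter> set y = {})"
    by (simp add: ball_conj_distrib)
  moreover have "(\<forall>x\<in>set xs. \<forall>y\<in>set (nonempty ss @ ys). set x \<inter> set y = {}) \<longleftrightarrow>
        (\<forall>x\<in>set xs. \<forall>s\<in>set (nonempty ss). set x \<inter> set s = {}) \<and>
        (\<forall>x\<in>set xs. \<forall>y\<in>set ys. set x \<inter> set y = {})"
    unfolding set_append ball_Un by (rule ball_conj_distrib)
  ultimately show ?thesis
    unfolding sorted_wrt_append sorted_wrt.simps disjoint_letters_nonempty by argo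
qed

text \<open>The output word \<open>l\<close> is kept arbitrary because the components to the right of the largest
  letter sort to \<open>p + 1, \<dots>, n\<close> rather than to an initial segment.\<close>

definition sortable_on :: "nat \<Rightarrow> nat list \<Rightarrow> nat list list \<Rightarrow> bool" where
  "sortable_on r l \<alpha> \<longleftrightarrow> disjoint_letters \<alpha> \<and> (\<forall>w\<in>set \<alpha>. w \<noteq> [] \<and> nested w) \<and>
     (\<forall>a\<in>set l. count_list (concat \<alpha>) a = r) \<and> stack_sort (concat (map stack_sort \<alpha>)) = l"

lemma set_concat_map_stack_sort [simp]: "set (concat (map stack_sort \<alpha>)) = set (concat \<alpha>)"
  by simp

lemma sortable_on_set: "sortable_on r l \<alpha> \<Longrightarrow> set (concat \<alpha>) = set l"
  unfolding sortable_on_def by (metis set_stack_sort set_concat_map_stack_sort)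

lemma r_permutation_iff_nested:
  "r_permutation r A w \<longleftrightarrow> set w = A \<and> (\<forall>a\<in>A. count_list w a = r) \<and> nested w"
  by (simp only: r_permutation_def nested_iff_nth)

lemma tuple_r_permutation_iff:
  "tuple_r_permutation r n k \<alpha> \<longleftrightarrow> length \<alpha> = k \<and> disjoint_letters \<alpha> \<and>
     (\<forall>w\<in>set \<alpha>. nested w) \<and> set (concat \<alpha>) = {1..n} \<and> (\<forall>a\<in>{1..n}. count_list (concat \<alpha>) a = r)"
proof (cases "length \<alpha> = k \<and> disjoint_letters \<alpha>")
  case True
  then show ?thesis
    unfolding tuple_r_permutation_def r_permutation_iff_nested
    using disjoint_letters_nth[of \<alpha>] nested_concat[of \<alpha>] by metis
next
  case False
  then show ?thesis
    unfolding tuple_r_permutation_def disjoint_letters_nth by blast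
qed

text \<open>Stack sorting preserves the set of letters, so the output \<open>[1..<n + 1]\<close>
  forces the letters to be 1, ..., n.\<close>

lemma mem_sortable_tuples_iff:
  "\<alpha> \<in> sortable_tuples r n k \<longleftrightarrow> length \<alpha> = k \<and> sortable_on r [1..<n + 1] \<alpha>"
proof -
  have letters: "set [1..<n + 1] = {1..n}" by auto
  have "set (concat \<alpha>) = {1..n}" if "stack_sort (concat (map stack_sort \<alpha>)) = [1..<n + 1]"
    using arg_cong[OF that, of set] by (simp only: set_stack_sort set_concat_map_stack_sort letters)
  then show ?thesis
    unfolding sortable_tuples_def tuple_r_permutation_iff sortable_on_def letters
      two_stack_sortable_def mem_Collect_eq by blast
qed

text \<open>Once the outputs are \<open>l1\<close> and \<open>l2\<close>, these give the letters of
  \<beta> and \<gamma>. Hence the two blocks are disjoint from each other and each letter is counted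
  in one block only.\<close>

lemma sortable_on_append:
  assumes "set l1 \<inter> set l2 = {}"
  shows "sortable_on r l1 \<beta> \<and> sortable_on r l2 \<gamma> \<longleftrightarrow>
     disjoint_letters (\<beta> @ \<gamma>) \<and> (\<forall>w\<in>set (\<beta> @ \<gamma>). w \<noteq> [] \<and> nested w) \<and>
     (\<forall>a\<in>set (l1 @ l2). count_list (concat (\<beta> @ \<gamma>)) a = r) \<and>
     stack_sort (concat (map stack_sort \<beta>)) = l1 \<and> stack_sort (concat (map stack_sort \<gamma>)) = l2"
proof (cases "stack_sort (concat (map stack_sort \<beta>)) = l1 \<and> stack_sort (concat (map stack_sort \<gamma>)) = l2")
  case True
  then have sets: "set (concat \<beta>) = set l1" "set (concat \<gamma>) = set l2"
    by (metis set_stack_sort set_concat_map_stack_sort)+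
  have "count_list (concat \<gamma>) a = 0" if "a \<in> set l1" for a
    using that assms sets by (simp add: count_list_0_iff del: set_concat) blast
  moreover have "count_list (concat \<beta>) a = 0" if "a \<in> set l2" for a
    using that assms sets by (simp add: count_list_0_iff del: set_concat) blast
  moreover have "\<forall>u\<in>set \<beta>. \<forall>v\<in>set \<gamma>. set u \<inter> set v = {}"
    using assms unfolding sets[symmetric] by auto
  ultimately show ?thesis
    using True unfolding sortable_on_def sorted_wrt_append
    by (auto simp: ball_Un simp del: set_concat)
qed (auto simp: sortable_on_def)

text \<open>The largest letter \<open>m\<close> is the root of its component: the first pass outputs \<open>L m R\<close> and the
  second one \<open>S(L) S(R) m\<close>, which is sorted iff \<open>S(L) S(R)\<close> is.\<close>

lemma sortable_on_join:
  assumes len: "length ss = Suc r" "r \<ge> 1" and m: "m \<notin> set (concat (xs @ ss @ ys))"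
    and l: "distinct l" "\<forall>a\<in>set l. a < m"
  shows "sortable_on r (l @ [m]) (xs @ join m ss # ys) \<longleftrightarrow>
     (\<exists>l1 l2. l = l1 @ l2 \<and> sortable_on r l1 (xs @ nonempty ss) \<and> sortable_on r l2 ys)"
proof -
  let ?\<alpha> = "xs @ join m ss # ys" and ?\<beta> = "xs @ nonempty ss"
  let ?L = "concat (map stack_sort ?\<beta>)" and ?R = "concat (map stack_sort ys)"
  have set\<beta>: "set (concat ?\<beta>) = set (concat xs) \<union> set (concat ss)"
    by (simp only: concat_append set_append concat_nonempty)
  have set\<alpha>: "set (concat ?\<alpha>) = insert m (set (concat ?\<beta>) \<union> set (concat ys))"
    unfolding set\<beta> using len by (auto simp: set_join)
  have count: "count_list (concat ?\<alpha>) a =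
      (if a = m then r else count_list (concat ?\<beta>) a + count_list (concat ys) a)" for a
    using m len by (auto simp: count_list_join)
  have sort: "stack_sort (concat (map stack_sort ?\<alpha>)) = stack_sort ?L @ stack_sort ?R @ [m]"
    if "\<forall>a\<in>set (concat ?\<beta>) \<union> set (concat ys). a < m"
  proof -
    have "stack_sort (join m ss) = concat (map stack_sort ss) @ [m]"
      using that len by (intro stack_sort_join) (auto simp: set\<beta> simp del: set_concat)
    hence "concat (map stack_sort ?\<alpha>) = ?L @ m # ?R"
      by (simp add: concat_map_nonempty)
    moreover have "\<forall>a\<in>set ?L \<union> set ?R. a < m"
      using that by (simp only: set_concat_map_stack_sort)
    ultimately show ?thesis
      using stack_sort_distinct by presburger
  qed
  have ne: "join m ss \<noteq> []"
    using len set_join[of m ss] by force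
  have nested_iff: "nested (join m ss) \<longleftrightarrow> disjoint_letters ss \<and> (\<forall>s\<in>set (nonempty ss). nested s)"
    if "\<forall>a\<in>set (concat ?\<beta>) \<union> set (concat ys). a < m"
  proof -
    have "\<forall>a\<in>set (concat ss). a < m" using that set\<beta> by blast
    from nested_join[OF this] show ?thesis by (auto intro: nested_Nil)
  qed
  \<comment> \<open>The conjunct \<open>disjoint_letters ss\<close> on the left is supplied by
    \<open>nested_iff\<close>.\<close>
  have dj: "disjoint_letters ?\<alpha> \<and> disjoint_letters ss \<longleftrightarrow> disjoint_letters (?\<beta> @ ys)"
    using m disjoint_letters_join[of m xs ys ss] by simp
  have sortable_iff: "sortable_on r (l @ [m]) ?\<alpha> \<longleftrightarrow>
     disjoint_letters (?\<beta> @ ys) \<and> (\<forall>w\<in>set (?\<beta> @ ys). w \<noteq> [] \<and> nested w) \<and>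
     (\<forall>a\<in>set l. count_list (concat (?\<beta> @ ys)) a = r) \<and> stack_sort ?L @ stack_sort ?R = l"
    if lt: "\<forall>a\<in>set (concat ?\<beta>) \<union> set (concat ys). a < m"
  proof -
    have "(\<forall>w\<in>set ?\<alpha>. w \<noteq> [] \<and> nested w) \<longleftrightarrow>
        disjoint_letters ss \<and> (\<forall>w\<in>set (?\<beta> @ ys). w \<noteq> [] \<and> nested w)"
      using ne nested_iff[OF lt] by auto
    moreover have "(\<forall>a\<in>set (l @ [m]). count_list (concat ?\<alpha>) a = r) \<longleftrightarrow>
        (\<forall>a\<in>set l. count_list (concat (?\<beta> @ ys)) a = r)"
    proof -
      have "count_list (concat ?\<alpha>) a = count_list (concat (?\<beta> @ ys)) a" if "a \<in> set l" for a
        using that l(2) count[of a] by auto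
      moreover have "count_list (concat ?\<alpha>) m = r" using count[of m] by simp
      ultimately show ?thesis by (simp del: concat_append)
    qed
    moreover have "stack_sort (concat (map stack_sort ?\<alpha>)) = l @ [m] \<longleftrightarrow> stack_sort ?L @ stack_sort ?R = l"
      using sort[OF lt] by simp
    ultimately show ?thesis
      unfolding sortable_on_def using dj by blast
  qed
  show ?thesis
  proof
    assume s: "sortable_on r (l @ [m]) ?\<alpha>"
    \<comment> \<open>The bound comes from the output: the letters of the tuple are those of
      \<open>l\<close> together with \<open>m\<close>, and \<open>m\<close> occurs in none of the
      pieces.\<close>
    have lt: "\<forall>a\<in>set (concat ?\<beta>) \<union> set (concat ys). a < m"
    proof
      fix a assume a: "a \<in> set (concat ?\<beta>) \<union> set (concat ys)"
      then have "a \<in> set (l @ [m])"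
        using sortable_on_set[OF s] set\<alpha> by blast
      moreover have "a \<noteq> m" using a m by auto
      ultimately show "a < m" using l by auto
    qed
    have l_eq: "l = stack_sort ?L @ stack_sort ?R"
      using s sortable_iff[OF lt] by blast
    then have "set (stack_sort ?L) \<inter> set (stack_sort ?R) = {}"
      using l(1) by (simp only: distinct_append)
    from sortable_on_append[OF this, of r ?\<beta> ys] s l_eq
    show "\<exists>l1 l2. l = l1 @ l2 \<and> sortable_on r l1 ?\<beta> \<and> sortable_on r l2 ys"
      unfolding sortable_iff[OF lt] by metis
  next
    assume "\<exists>l1 l2. l = l1 @ l2 \<and> sortable_on r l1 ?\<beta> \<and> sortable_on r l2 ys"
    then obtain l1 l2 where l12: "l = l1 @ l2" "sortable_on r l1 ?\<beta>" "sortable_on r l2 ys"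
      by blast
    have lt: "\<forall>a\<in>set (concat ?\<beta>) \<union> set (concat ys). a < m"
      using l l12(1) unfolding sortable_on_set[OF l12(2)] sortable_on_set[OF l12(3)] by auto
    have "set l1 \<inter> set l2 = {}" using l(1) l12(1) by simp
    from sortable_on_append[OF this, of r ?\<beta> ys] l12
    show "sortable_on r (l @ [m]) ?\<alpha>"
      unfolding sortable_iff[OF lt] by metis
  qed
qed

section \<open>Strictly increasing relabelling of a tuple\<close>

lemma count_list_map_inj: "inj f \<Longrightarrow> count_list (map f w) (f a) = count_list w a"
  by (induction w) (auto simp: inj_eq)

lemma nested_map:
  assumes "strict_mono (f :: nat \<Rightarrow> nat)"
  shows "nested (map f w) \<longleftrightarrow> nested w"
proof -
  have "(i < j \<and> j < k \<and> k < length (map f w) \<and> map f w ! i = map f w ! k \<longrightarrow> map f w ! j \<le> map f w ! i)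
      \<longleftrightarrow> (i < j \<and> j < k \<and> k < length w \<and> w ! i = w ! k \<longrightarrow> w ! j \<le> w ! i)" for i j k
    by (cases "i < j \<and> j < k \<and> k < length w")
       (auto simp: strict_mono_eq[OF assms] strict_mono_less_eq[OF assms])
  thus ?thesis unfolding nested_iff_nth by simp
qed

lemma disjoint_letters_map:
  "inj f \<Longrightarrow> disjoint_letters (map (map f) \<alpha>) \<longleftrightarrow> disjoint_letters \<alpha>"
  by (simp add: sorted_wrt_map image_Int[symmetric])

lemma sortable_on_map:
  assumes "strict_mono f"
  shows "sortable_on r (map f l) (map (map f) \<alpha>) \<longleftrightarrow> sortable_on r l \<alpha>"
proof -
  have inj: "inj f" using assms by (rule strict_mono_imp_inj_on)
  have "concat (map stack_sort (map (map f) \<alpha>)) = map f (concat (map stack_sort \<alpha>))"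
    by (simp add: stack_sort_map[OF assms] map_concat comp_def)
  hence "stack_sort (concat (map stack_sort (map (map f) \<alpha>))) = map f (stack_sort (concat (map stack_sort \<alpha>)))"
    by (simp add: stack_sort_map[OF assms])
  moreover have "concat (map (map f) \<alpha>) = map f (concat \<alpha>)"
    by (simp add: map_concat)
  ultimately show ?thesis
    unfolding sortable_on_def
    by (simp add: count_list_map_inj[OF inj] nested_map[OF assms] disjoint_letters_map[OF inj]
        inj_map_eq_map[OF inj] del: concat_map_singleton)
qed

section \<open>Descents and weights\<close>

lemma two_letters_at: "p + 1 < length w \<Longrightarrow> w = take p w @ w ! p # w ! (p + 1) # drop (p + 2) w"
  by (simp add: Cons_nth_drop_Suc)

text \<open>Factors in place of positions let append decompositions do the work. As
  \<open>b < a\<close>, the condition \<open>a \<notin> set xs\<close> makes the displayed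
  \<open>a\<close> the first occurrence.\<close>

lemma descents_0: "descents 0 w = {a. \<exists>xs b ys. w = xs @ b # a # ys \<and> b < a \<and> a \<notin> set xs}"
proof (intro set_eqI iffI)
  fix a assume "a \<in> descents 0 w"
  then obtain p where p: "p + 1 < length w" "w ! (p + 1) = a" "count_list (take (p + 2) w) a = 1" "w ! p < a"
    by (auto simp: descents_def occurrence_def)
  have "take (p + 2) w = take p w @ [w ! p, w ! (p + 1)]"
    using p(1) by (simp add: take_Suc_conv_app_nth)
  with p have "a \<notin> set (take p w)"
    by (auto simp: count_list_0_iff)
  with p two_letters_at[OF p(1)]
  show "a \<in> {a. \<exists>xs b ys. w = xs @ b # a # ys \<and> b < a \<and> a \<notin> set xs}" by blast
next
  fix a assume "a \<in> {a. \<exists>xs b ys. w = xs @ b # a # ys \<and> b < a \<and> a \<notin> set xs}"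
  then obtain xs b ys where w: "w = xs @ b # a # ys" "b < a" "a \<notin> set xs" by blast
  then have "occurrence w 1 a (length xs + 1)" "w ! length xs < a"
    by (auto simp: occurrence_def nth_append count_notin)
  then show "a \<in> descents 0 w" by (auto simp: descents_def)
qed

text \<open>The displayed \<open>a\<close> is occurrence i + 1, being preceded by i copies in
  \<open>xs\<close>.\<close>

lemma descents_Suc:
  "descents (Suc i) w = {a. \<exists>xs b ys. w = xs @ a # b # ys \<and> b < a \<and> count_list xs a = i}"
proof (intro set_eqI iffI)
  fix a assume "a \<in> descents (Suc i) w"
  then obtain p where p: "p + 1 < length w" "w ! p = a" "count_list (take (p + 1) w) a = Suc i" "w ! (p + 1) < a"
    by (auto simp: descents_def occurrence_def)
  have "take (p + 1) w = take p w @ [w ! p]"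
    using p(1) by (simp add: take_Suc_conv_app_nth)
  with p have "count_list (take p w) a = i" by simp
  with p two_letters_at[OF p(1)]
  show "a \<in> {a. \<exists>xs b ys. w = xs @ a # b # ys \<and> b < a \<and> count_list xs a = i}" by blast
next
  fix a assume "a \<in> {a. \<exists>xs b ys. w = xs @ a # b # ys \<and> b < a \<and> count_list xs a = i}"
  then obtain xs b ys where w: "w = xs @ a # b # ys" "b < a" "count_list xs a = i" by blast
  then have "occurrence w (Suc i) a (length xs)" "length xs + 1 < length w" "w ! (length xs + 1) < a"
    by (auto simp: occurrence_def nth_append)
  then show "a \<in> descents (Suc i) w" by (auto simp: descents_def)
qed

lemma descents_subset: "descents i w \<subseteq> set w"
  by (cases i) (auto simp: descents_0 descents_Suc)

lemma descents_Nil [simp]: "descents i [] = {}"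
  using descents_subset[of i "[]"] by simp

text \<open>The factor a b does not contain \<open>m\<close>, so it lies entirely on one side of
  it.\<close>

lemma append_eq_two_letters:
  assumes "a \<noteq> m" "b \<noteq> m"
  shows "u @ m # v = xs @ a # b # ys \<longleftrightarrow>
     (\<exists>us. u = xs @ a # b # us \<and> ys = us @ m # v) \<or> (\<exists>us. xs = u @ m # us \<and> v = us @ a # b # ys)"
  using assms by (auto simp: append_eq_append_conv2 Cons_eq_append_conv append_eq_Cons_conv)

text \<open>A descent of a letter a < m pairs it with a smaller letter, so this factor lies inside
  \<open>u\<close> or inside \<open>v\<close>. A letter of \<open>v\<close> is absent from
  \<open>u\<close>, so the prefix \<open>u @ [m]\<close> leaves its occurrence numbers
  unchanged.\<close>

lemma descents_insert_max:
  assumes u: "\<forall>a\<in>set u. a < m" and v: "\<forall>a\<in>set v. a \<le> m" and disj: "set u \<inter> set v = {}"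
  shows "descents i (u @ m # v) - {m} = descents i u \<union> (descents i v - {m})"
proof (intro set_eqI)
  fix a
  have mu: "m \<notin> set u" using u by auto
  show "a \<in> descents i (u @ m # v) - {m} \<longleftrightarrow> a \<in> descents i u \<union> (descents i v - {m})"
  proof (cases "a \<in> set u \<union> set v - {m}")
    case False
    then show ?thesis
      using descents_subset[of i "u @ m # v"] descents_subset[of i u] descents_subset[of i v] mu by auto
  next
    case True
    then have am: "a \<noteq> m" "a < m" using u v by auto
    show ?thesis
    proof (cases i)
      case 0
      have split: "u @ m # v = xs @ b # a # ys \<longleftrightarrow>
          (\<exists>us. u = xs @ b # a # us \<and> ys = us @ m # v) \<or> (\<exists>us. xs = u @ m # us \<and> v = us @ b # a # ys)"
        if "b < a" for xs b ys
        using that am by (intro append_eq_two_letters) auto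
      have "a \<in> descents 0 (u @ m # v) \<longleftrightarrow>
          (\<exists>xs b ys. b < a \<and> u @ m # v = xs @ b # a # ys \<and> a \<notin> set xs)"
        unfolding descents_0 by blast
      also have "\<dots> \<longleftrightarrow> (\<exists>xs b ys. b < a \<and> ((\<exists>us. u = xs @ b # a # us \<and> ys = us @ m # v) \<or>
          (\<exists>us. xs = u @ m # us \<and> v = us @ b # a # ys)) \<and> a \<notin> set xs)"
        by (simp only: split cong: conj_cong)
      also have "\<dots> \<longleftrightarrow>
          (\<exists>xs b ys. b < a \<and> (\<exists>us. u = xs @ b # a # us \<and> ys = us @ m # v) \<and> a \<notin> set xs) \<or>
          (\<exists>xs b ys. b < a \<and> (\<exists>us. xs = u @ m # us \<and> v = us @ b # a # ys) \<and> a \<notin> set xs)"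
        by (simp only: conj_disj_distribL conj_disj_distribR ex_disj_distrib)
      also have "(\<exists>xs b ys. b < a \<and> (\<exists>us. u = xs @ b # a # us \<and> ys = us @ m # v) \<and> a \<notin> set xs) \<longleftrightarrow>
          (\<exists>xs b us. u = xs @ b # a # us \<and> b < a \<and> a \<notin> set xs)"
        by blast
      also have "(\<exists>xs b ys. b < a \<and> (\<exists>us. xs = u @ m # us \<and> v = us @ b # a # ys) \<and> a \<notin> set xs) \<longleftrightarrow>
          (\<exists>us b ys. (v = us @ b # a # ys \<and> b < a) \<and> a \<notin> set (u @ m # us))"
        by blast
      also have "\<dots> \<longleftrightarrow> (\<exists>us b ys. (v = us @ b # a # ys \<and> b < a) \<and> a \<notin> set us)"
      proof -
        have "a \<notin> set u" if "v = us @ b # a # ys" for us b ys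
          using that disj by auto
        then have cond: "a \<notin> set (u @ m # us) \<longleftrightarrow> a \<notin> set us" if "v = us @ b # a # ys \<and> b < a" for us b ys
          using that am by (simp add: count_notin)
        show ?thesis by (intro ex_cong1 conj_cong refl) (erule cond)
      qed
      finally show ?thesis using am 0 by (simp add: descents_0)
    next
      case (Suc j)
      have split: "u @ m # v = xs @ a # b # ys \<longleftrightarrow>
          (\<exists>us. u = xs @ a # b # us \<and> ys = us @ m # v) \<or> (\<exists>us. xs = u @ m # us \<and> v = us @ a # b # ys)"
        if "b < a" for xs b ys
        using that am by (intro append_eq_two_letters) auto
      have "a \<in> descents i (u @ m # v) \<longleftrightarrow>
          (\<exists>xs b ys. b < a \<and> u @ m # v = xs @ a # b # ys \<and> count_list xs a = j)"
        unfolding descents_Suc Suc by blast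
      also have "\<dots> \<longleftrightarrow> (\<exists>xs b ys. b < a \<and> ((\<exists>us. u = xs @ a # b # us \<and> ys = us @ m # v) \<or>
          (\<exists>us. xs = u @ m # us \<and> v = us @ a # b # ys)) \<and> count_list xs a = j)"
        by (simp only: split cong: conj_cong)
      also have "\<dots> \<longleftrightarrow>
          (\<exists>xs b ys. b < a \<and> (\<exists>us. u = xs @ a # b # us \<and> ys = us @ m # v) \<and> count_list xs a = j) \<or>
          (\<exists>xs b ys. b < a \<and> (\<exists>us. xs = u @ m # us \<and> v = us @ a # b # ys) \<and> count_list xs a = j)"
        by (simp only: conj_disj_distribL conj_disj_distribR ex_disj_distrib)
      also have "(\<exists>xs b ys. b < a \<and> (\<exists>us. u = xs @ a # b # us \<and> ys = us @ m # v) \<and> count_list xs a = j) \<longleftrightarrow>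
          (\<exists>xs b us. u = xs @ a # b # us \<and> b < a \<and> count_list xs a = j)"
        by blast
      also have "(\<exists>xs b ys. b < a \<and> (\<exists>us. xs = u @ m # us \<and> v = us @ a # b # ys) \<and> count_list xs a = j) \<longleftrightarrow>
          (\<exists>us b ys. (v = us @ a # b # ys \<and> b < a) \<and> count_list (u @ m # us) a = j)"
        by blast
      also have "\<dots> \<longleftrightarrow> (\<exists>us b ys. (v = us @ a # b # ys \<and> b < a) \<and> count_list us a = j)"
      proof -
        have "a \<notin> set u" if "v = us @ a # b # ys" for us b ys
          using that disj by auto
        then have cond: "count_list (u @ m # us) a = j \<longleftrightarrow> count_list us a = j" if "v = us @ a # b # ys \<and> b < a" for us b ys
          using that am by (simp add: count_notin)
        show ?thesis by (intro ex_cong1 conj_cong refl) (erule cond)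
      qed
      finally show ?thesis using am Suc by (simp add: descents_Suc)
    qed
  qed
qed

lemma append_eq_letter:
  assumes "m \<notin> set u"
  shows "u @ m # v = xs @ m # zs \<longleftrightarrow> (xs = u \<and> zs = v) \<or> (\<exists>us. xs = u @ m # us \<and> v = us @ m # zs)"
  using assms by (auto simp: append_eq_append_conv2 Cons_eq_append_conv append_eq_Cons_conv)

text \<open>The displayed \<open>m\<close> is the first occurrence because \<open>u\<close> avoids
  it, so it decides types 0 and 1. Every later occurrence sits in \<open>v\<close> with its number
  lowered by one.\<close>

lemma max_mem_descents:
  assumes "\<forall>a\<in>set u. a < m" "\<forall>a\<in>set v. a \<le> m"
  shows "m \<in> descents 0 (u @ m # v) \<longleftrightarrow> u \<noteq> []"
    and "m \<in> descents (Suc 0) (u @ m # v) \<longleftrightarrow> v \<noteq> [] \<and> hd v \<noteq> m"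
    and "m \<in> descents (Suc (Suc i)) (u @ m # v) \<longleftrightarrow> m \<in> descents (Suc i) v"
proof -
  have mu: "m \<notin> set u" using assms(1) by auto
  show "m \<in> descents 0 (u @ m # v) \<longleftrightarrow> u \<noteq> []"
  proof
    assume "m \<in> descents 0 (u @ m # v)"
    then obtain xs b ys where "u @ m # v = (xs @ [b]) @ m # ys" "b < m" "m \<notin> set xs"
      by (auto simp: descents_0)
    then show "u \<noteq> []"
      by (cases u) (auto simp: Cons_eq_append_conv)
  next
    assume "u \<noteq> []"
    then have "u @ m # v = butlast u @ last u # m # v" "last u < m" "m \<notin> set (butlast u)"
      using assms(1) mu by (auto dest: in_set_butlastD)
    then show "m \<in> descents 0 (u @ m # v)"
      unfolding descents_0 by blast
  qed
  have "m \<in> descents (Suc 0) (u @ m # v) \<longleftrightarrow>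
      (\<exists>xs b ys. u @ m # v = xs @ m # b # ys \<and> b < m \<and> m \<notin> set xs)"
    by (auto simp: descents_Suc count_list_0_iff)
  also have "\<dots> \<longleftrightarrow> (\<exists>b ys. v = b # ys \<and> b < m)"
    using mu by (auto simp: append_eq_letter)
  also have "\<dots> \<longleftrightarrow> v \<noteq> [] \<and> hd v \<noteq> m"
    using assms(2) by (cases v) auto
  finally show "m \<in> descents (Suc 0) (u @ m # v) \<longleftrightarrow> v \<noteq> [] \<and> hd v \<noteq> m" .
  show "m \<in> descents (Suc (Suc i)) (u @ m # v) \<longleftrightarrow> m \<in> descents (Suc i) v"
  proof
    assume "m \<in> descents (Suc (Suc i)) (u @ m # v)"
    then obtain xs b ys where *: "u @ m # v = xs @ m # b # ys" "b < m" "count_list xs m = Suc i"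
      unfolding descents_Suc by blast
    then obtain us where "xs = u @ m # us" "v = us @ m # b # ys"
      using mu unfolding append_eq_letter[OF mu] by (auto simp: count_notin)
    then show "m \<in> descents (Suc i) v"
      using * mu unfolding descents_Suc by (auto simp: count_notin)
  next
    assume "m \<in> descents (Suc i) v"
    then obtain us b ys where *: "v = us @ m # b # ys" "b < m" "count_list us m = i"
      unfolding descents_Suc by blast
    then have "u @ m # v = (u @ m # us) @ m # b # ys" "count_list (u @ m # us) m = Suc i"
      using mu by (auto simp: count_notin)
    then show "m \<in> descents (Suc (Suc i)) (u @ m # v)"
      using * unfolding descents_Suc by blast
  qed
qed

text \<open>With entries counted from 0, the ith copy of \<open>m\<close> is followed by entry i,
  and the first copy is preceded by entry 0. So entry i decides whether \<open>m\<close> is a type i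
  descent, uniformly in i.\<close>

lemma descents_join:
  assumes "\<forall>a\<in>set (concat ss). a < m" "disjoint_letters ss" "2 \<le> length ss"
  shows "descents i (join m ss) =
     (\<Union>s\<in>set ss. descents i s) \<union> (if i < length ss \<and> ss ! i \<noteq> [] then {m} else {})"
proof -
  have "descents i (join m ss) - {m} = (\<Union>s\<in>set ss. descents i s)"
    using assms(1,2)
  proof (induction m ss rule: join.induct)
    case (2 m s)
    then show ?case using descents_subset[of i s] by auto
  next
    case (3 m s t ss)
    let ?v = "join m (t # ss)"
    have "\<forall>a\<in>set s. a < m" "\<forall>a\<in>set ?v. a \<le> m" "set s \<inter> set ?v = {}"
      using 3(2,3) by (auto simp: set_join less_imp_le)
    from descents_insert_max[OF this, of i] 3 show ?case by auto
  qed simp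
  moreover have "m \<in> descents i (join m ss) \<longleftrightarrow> 2 \<le> length ss \<and> i < length ss \<and> ss ! i \<noteq> []"
    using assms(1)
  proof (induction m ss arbitrary: i rule: join.induct)
    case (2 m s)
    then show ?case using descents_subset[of i s] by auto
  next
    case (3 m s t ss)
    let ?v = "join m (t # ss)"
    have le: "\<forall>a\<in>set s. a < m" "\<forall>a\<in>set ?v. a \<le> m"
      using 3(2) by (auto simp: set_join less_imp_le)
    \<comment> \<open>If \<open>t\<close> is empty, then \<open>?v\<close> is empty or starts with
      the next copy of \<open>m\<close>.\<close>
    have "?v \<noteq> [] \<and> hd ?v \<noteq> m \<longleftrightarrow> t \<noteq> []"
      using 3(2) by (auto simp: join_Cons hd_append)
    moreover have "\<forall>a\<in>set (concat (t # ss)). a < m" using 3(2) by auto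
    note 3(1)[OF this]
    ultimately show ?case
      using max_mem_descents[OF le] by (cases i rule: nat.exhaust; cases "i - 1") auto
  qed simp
  ultimately show ?thesis
    using assms(3) by (auto split: if_splits)
qed

section \<open>Descents and weights of tuples\<close>

lemma tuple_descents_subset: "tuple_descents i \<alpha> \<subseteq> set (concat \<alpha>)"
  using descents_subset by (fastforce simp: tuple_descents_def)

lemma finite_tuple_descents: "finite (tuple_descents i \<alpha>)"
  by (rule finite_subset[OF tuple_descents_subset]) simp

lemma tuple_descents_join:
  assumes "\<forall>a\<in>set (concat ss). a < m" "disjoint_letters ss" "2 \<le> length ss"
  shows "tuple_descents i (xs @ join m ss # ys) =
     tuple_descents i (xs @ nonempty ss) \<union> tuple_descents i ys \<union>
     (if i < length ss \<and> ss ! i \<noteq> [] then {m} else {})"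
  unfolding tuple_descents_def set_append list.set UN_Un UN_insert descents_join[OF assms] by auto

text \<open>By \<open>descents_join\<close> these are the descent types of the separating
  letter.\<close>

definition slots :: "'a list list \<Rightarrow> nat set" where
  "slots ss = {i. i < length ss \<and> ss ! i \<noteq> []}"

text \<open>For each type, the descents of the left block, those of \<open>ys\<close> and the letter
  \<open>m\<close> are disjoint. So their numbers add and the weights multiply.\<close>

lemma weight_join:
  assumes "\<forall>a\<in>set (concat (xs @ ss @ ys)). a < m" "disjoint_letters (xs @ ss @ ys)" "length ss = Suc r" "r \<ge> 1"
  shows "weight r (xs @ join m ss # ys) =
     (\<Prod>i\<in>slots ss. mvar i) * weight r (xs @ nonempty ss) * weight r ys"
proof -
  have td: "card (tuple_descents i (xs @ join m ss # ys)) =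
      (if i \<in> slots ss then 1 else 0) + card (tuple_descents i (xs @ nonempty ss)) + card (tuple_descents i ys)" for i
  proof -
    let ?A = "tuple_descents i (xs @ nonempty ss)" and ?B = "tuple_descents i ys"
    have "set (concat (xs @ nonempty ss)) = set (concat xs) \<union> set (concat ss)"
      by (simp only: concat_append set_append concat_nonempty)
    then have A: "?A \<subseteq> set (concat xs) \<union> set (concat ss)"
      using tuple_descents_subset by blast
    have B: "?B \<subseteq> set (concat ys)" by (rule tuple_descents_subset)
    have "(set (concat xs) \<union> set (concat ss)) \<inter> set (concat ys) = {}"
      using assms(2) by (auto simp: sorted_wrt_append)
    with A B have "?A \<inter> ?B = {}" by blast
    moreover have "m \<notin> set (concat xs) \<union> set (concat ss) \<union> set (concat ys)"
      using assms(1) by auto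
    with A B have "m \<notin> ?A \<union> ?B" by blast
    moreover have "tuple_descents i (xs @ join m ss # ys) = ?A \<union> ?B \<union> (if i \<in> slots ss then {m} else {})"
      using assms by (subst tuple_descents_join) (auto simp: sorted_wrt_append slots_def)
    ultimately show ?thesis
      by (simp add: card_Un_disjoint finite_tuple_descents)
  qed
  have "slots ss \<subseteq> {..r}" using assms(3) by (auto simp: slots_def)
  then have "(\<Prod>i\<in>slots ss. mvar i) = (\<Prod>i\<le>r. mvar i ^ (if i \<in> slots ss then 1 else 0))"
    by (intro prod.mono_neutral_cong_left) auto
  then show ?thesis
    by (simp add: weight_def td power_add prod.distrib)
qed

lemma descents_map:
  assumes "strict_mono f"
  shows "descents i (map f w) = f ` descents i w"
proof -
  have inj: "inj f" using assms by (rule strict_mono_imp_inj_on)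
  have split: "map f w = xs @ c # d # zs \<longleftrightarrow> (\<exists>xs' c' d' zs'. w = xs' @ c' # d' # zs' \<and>
      xs = map f xs' \<and> c = f c' \<and> d = f d' \<and> zs = map f zs')" (is "?L \<longleftrightarrow> ?R") for xs c d zs
  proof
    assume ?L
    then show ?R by (auto simp: map_eq_append_conv map_eq_Cons_conv)
  next
    assume ?R
    then show ?L by auto
  qed
  show ?thesis
  proof (cases i)
    case 0
    have "a \<in> descents 0 (map f w) \<longleftrightarrow> (\<exists>xs b a' ys. w = xs @ b # a' # ys \<and> a = f a' \<and>
        f b < f a' \<and> f a' \<notin> set (map f xs))" for a
      unfolding descents_0 mem_Collect_eq split by blast
    then show ?thesis
      unfolding 0 by (simp add: strict_mono_less[OF assms] inj_image_mem_iff[OF inj])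
        (unfold descents_0, blast)
  next
    case (Suc j)
    have "a \<in> descents (Suc j) (map f w) \<longleftrightarrow> (\<exists>xs b a' ys. w = xs @ a' # b # ys \<and> a = f a' \<and>
        f b < f a' \<and> count_list (map f xs) (f a') = j)" for a
      unfolding descents_Suc mem_Collect_eq split by blast
    then show ?thesis
      unfolding Suc by (simp add: strict_mono_less[OF assms] count_list_map_inj[OF inj])
        (unfold descents_Suc, blast)
  qed
qed

lemma weight_map:
  assumes "strict_mono f"
  shows "weight r (map (map f) \<alpha>) = weight r \<alpha>"
proof -
  have "tuple_descents i (map (map f) \<alpha>) = f ` tuple_descents i \<alpha>" for i
    by (auto simp: tuple_descents_def descents_map[OF assms])
  then show ?thesis
    by (simp add: weight_def card_image[OF inj_on_subset[OF strict_mono_imp_inj_on[OF assms] subset_UNIV]])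
qed

section \<open>The recursion for the polynomials\<close>

fun fill :: "bool list \<Rightarrow> 'a list list \<Rightarrow> 'a list list" where
  "fill [] cs = []"
| "fill (True # bs) cs = hd cs # fill bs (tl cs)"
| "fill (False # bs) cs = [] # fill bs cs"

text \<open>With one entry for every \<open>True\<close>, \<open>hd\<close> is never applied to
  \<open>[]\<close>, and both arguments of \<open>fill\<close> can be read off the result. Together
  with \<open>fill_nonempty\<close>, this encodes a list of words by the positions and contents of
  its nonempty entries.\<close>

lemma fill_properties:
  assumes "length cs = length (filter id bs)" "[] \<notin> set cs"
  shows "nonempty (fill bs cs) = cs" "map (\<lambda>s. s \<noteq> []) (fill bs cs) = bs"
  using assms
proof (induction bs cs rule: fill.induct)
  case (2 bs cs)
  { case 1 with 2 show ?case by (cases cs) auto }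
  { case 2 with "2.IH" show ?case by (cases cs) auto }
qed auto

lemma fill_nonempty: "fill (map (\<lambda>s. s \<noteq> []) ss) (nonempty ss) = ss"
  by (induction ss) auto

lemma length_fill [simp]: "length (fill bs cs) = length bs"
  by (induction bs cs rule: fill.induct) auto

definition fill_slots :: "nat \<Rightarrow> nat set \<Rightarrow> 'a list list \<Rightarrow> 'a list list" where
  "fill_slots r A cs = fill (map (\<lambda>i. i \<in> A) [0..<Suc r]) cs"

lemma length_fill_slots [simp]: "length (fill_slots r A cs) = Suc r"
  by (simp add: fill_slots_def)

lemma fill_slots_properties:
  assumes A: "A \<subseteq> {..r}" and cs: "length cs = card A" "[] \<notin> set cs"
  shows "nonempty (fill_slots r A cs) = cs" "slots (fill_slots r A cs) = A"
proof -
  let ?bs = "map (\<lambda>i. i \<in> A) [0..<Suc r]"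
  have "length (filter id ?bs) = length (filter (\<lambda>i. i \<in> A) [0..<Suc r])"
    by (simp add: filter_map comp_def del: upt_Suc)
  also have "\<dots> = card (set (filter (\<lambda>i. i \<in> A) [0..<Suc r]))"
    by (rule distinct_card[symmetric]) (simp del: upt_Suc)
  also have "set (filter (\<lambda>i. i \<in> A) [0..<Suc r]) = A"
    using A by (auto simp del: upt_Suc)
  finally have "length cs = length (filter id ?bs)" using cs(1) by (rule trans[OF _ sym, rotated])
  note fill = fill_properties[OF this cs(2)]
  show "nonempty (fill_slots r A cs) = cs"
    unfolding fill_slots_def by (rule fill(1))
  have "fill_slots r A cs ! i \<noteq> [] \<longleftrightarrow> i \<in> A" if "i < Suc r" for i
  proof -
    have "map (\<lambda>s. s \<noteq> []) (fill_slots r A cs) ! i = ?bs ! i"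
      unfolding fill_slots_def fill(2) ..
    then show ?thesis using that by (simp del: upt_Suc)
  qed
  then show "slots (fill_slots r A cs) = A"
    using A by (auto simp: slots_def subset_iff less_Suc_eq_le)
qed

lemma fill_slots_slots: "length ss = Suc r \<Longrightarrow> fill_slots r (slots ss) (nonempty ss) = ss"
proof -
  assume "length ss = Suc r"
  then have "map (\<lambda>i. i \<in> slots ss) [0..<Suc r] = map (\<lambda>s. s \<noteq> []) ss"
    by (intro nth_equalityI) (auto simp: slots_def simp del: upt_Suc)
  then show ?thesis by (simp add: fill_slots_def fill_nonempty)
qed

lemma card_slots: "card (slots ss) = length (nonempty ss)"
  by (simp add: slots_def length_filter_conv_card)

section \<open>The bijection that removes the largest letter\<close>

lemma max_component_unique:
  assumes "xs @ w # ys = xs' @ w' # ys'"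
    and "m \<in> set w" "m \<notin> set (concat xs)" "m \<notin> set (concat ys)"
    and "m \<in> set w'" "m \<notin> set (concat xs')" "m \<notin> set (concat ys')"
  shows "xs = xs'" "w = w'" "ys = ys'"
  using assms by (auto simp: append_eq_append_conv2 Cons_eq_append_conv append_eq_Cons_conv)

text \<open>\<open>i\<close> components precede the one containing the largest letter, \<open>A\<close> is the set of the nonempty
  words among the \<open>r + 1\<close> words that this letter separates, and \<open>p\<close> is the number of letters of \<open>\<beta>\<close>.\<close>

definition build :: "nat \<Rightarrow> nat \<Rightarrow> nat \<times> nat set \<times> nat \<times> nat list list \<times> nat list list \<Rightarrow> nat list list" where
  "build r n = (\<lambda>(i, A, p, \<beta>, \<gamma>).
     take i \<beta> @ join (Suc n) (fill_slots r A (drop i \<beta>)) # map (map ((+) p)) \<gamma>)"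

text \<open>These are the data for tuples with k + 1 components on n + 1 letters. The left block has
  i + card A components, as only nonempty words count. All \<open>p\<close> from 0 to n occur, since
  the output 1, ..., n may be cut anywhere.\<close>

definition pieces :: "nat \<Rightarrow> nat \<Rightarrow> nat \<Rightarrow> (nat \<times> nat set \<times> nat \<times> nat list list \<times> nat list list) set" where
  "pieces r n k = (SIGMA i:{..k}. SIGMA A:Pow {..r}. SIGMA p:{..n}.
     sortable_tuples r p (i + card A) \<times> sortable_tuples r (n - p) (k - i))"

lemma strict_mono_plus: "strict_mono ((+) (p :: nat))"
  by (simp add: strict_mono_def)

lemma map_plus_upt: "map ((+) p) [1..<n - p + 1] = [p + 1..<n + 1]" if "p \<le> n"
  using that by (intro nth_equalityI) (auto simp del: upt_Suc)

text \<open>Shifting \<gamma> by \<open>p\<close> moves its output to p + 1, ..., n, which continues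
  the output 1, ..., p of \<beta>; \<open>sortable_on_join\<close> then gives membership. The other
  conclusions serve injectivity and the weight.\<close>

lemma build_properties:
  assumes r: "r \<ge> 1" and x: "(i, A, p, \<beta>, \<gamma>) \<in> pieces r n k"
  defines "ss \<equiv> fill_slots r A (drop i \<beta>)" and "ys \<equiv> map (map ((+) p)) \<gamma>"
  shows "build r n (i, A, p, \<beta>, \<gamma>) = take i \<beta> @ join (Suc n) ss # ys"
    and "length (take i \<beta>) = i" "slots ss = A" "nonempty ss = drop i \<beta>" "set (concat \<beta>) = {1..p}"
    and "\<forall>a\<in>set (concat (take i \<beta> @ ss @ ys)). a < Suc n"
    and "disjoint_letters (take i \<beta> @ ss @ ys)"
    and "build r n (i, A, p, \<beta>, \<gamma>) \<in> sortable_tuples r (Suc n) (Suc k)"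
proof -
  from x have i: "i \<le> k" "A \<subseteq> {..r}" "p \<le> n" and \<beta>: "length \<beta> = i + card A" "sortable_on r [1..<p + 1] \<beta>"
    and \<gamma>: "length \<gamma> = k - i" "sortable_on r [1..<n - p + 1] \<gamma>"
    unfolding pieces_def by (auto simp: mem_sortable_tuples_iff simp del: upt_Suc)
  show b: "build r n (i, A, p, \<beta>, \<gamma>) = take i \<beta> @ join (Suc n) ss # ys"
    by (simp add: build_def ss_def ys_def)
  show "length (take i \<beta>) = i" using \<beta> by simp
  have "[] \<notin> set (drop i \<beta>)"
    using \<beta>(2) by (auto simp: sortable_on_def dest: in_set_dropD)
  note fill = fill_slots_properties[OF i(2) _ this]
  show "slots ss = A" and ne: "nonempty ss = drop i \<beta>"
    using fill \<beta>(1) by (simp_all add: ss_def)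
  then have \<beta>': "take i \<beta> @ nonempty ss = \<beta>" by simp
  show set\<beta>: "set (concat \<beta>) = {1..p}"
    using sortable_on_set[OF \<beta>(2)] by auto
  have ys: "sortable_on r [p + 1..<n + 1] ys"
    using \<gamma>(2) sortable_on_map[OF strict_mono_plus, of r p "[1..<n - p + 1]" \<gamma>] map_plus_upt[OF i(3)]
    by (simp add: ys_def del: upt_Suc)
  have setys: "set (concat ys) = {p + 1..n}"
    using sortable_on_set[OF ys] by auto
  have set\<beta>': "set (concat \<beta>) = set (concat (take i \<beta>)) \<union> set (concat ss)"
    using arg_cong[OF \<beta>', of "\<lambda>x. set (concat x)"] by (simp only: concat_append set_append concat_nonempty)
  show lt: "\<forall>a\<in>set (concat (take i \<beta> @ ss @ ys)). a < Suc n"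
    unfolding concat_append set_append Un_assoc[symmetric] set\<beta>'[symmetric] set\<beta> setys using i by auto
  have upt: "[1..<Suc n + 1] = [1..<n + 1] @ [Suc n]" by simp
  have "[1..<n + 1] = [1..<p + 1] @ [p + 1..<n + 1]"
    using i upt_add_eq_append[of 1 "p + 1" "n - p"] by (simp del: upt_Suc)
  moreover have "sortable_on r ([1..<n + 1] @ [Suc n]) (take i \<beta> @ join (Suc n) ss # ys) \<longleftrightarrow>
     (\<exists>l1 l2. [1..<n + 1] = l1 @ l2 \<and> sortable_on r l1 (take i \<beta> @ nonempty ss) \<and> sortable_on r l2 ys)"
    by (rule sortable_on_join) (use r lt in \<open>auto simp: ss_def\<close>)
  ultimately have "sortable_on r [1..<Suc n + 1] (take i \<beta> @ join (Suc n) ss # ys)"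
    unfolding upt \<beta>' using \<beta>(2) ys by blast
  moreover have "length (take i \<beta> @ join (Suc n) ss # ys) = Suc k"
    using i \<beta>(1) \<gamma>(1) by (simp add: ys_def)
  ultimately show "build r n (i, A, p, \<beta>, \<gamma>) \<in> sortable_tuples r (Suc n) (Suc k)"
    unfolding b mem_sortable_tuples_iff by blast
  \<comment> \<open>Empty words affect no disjointness, so it passes from \<beta> and
    \<open>ys\<close> to the list that still contains the empty entries of
    \<open>ss\<close>.\<close>
  have "(\<Union>w\<in>set \<beta>. set w) \<inter> (\<Union>w\<in>set ys. set w) = {}"
    using set\<beta> setys by auto
  then have "disjoint_letters (\<beta> @ ys)"
    using \<beta>(2) ys unfolding sorted_wrt_append sortable_on_def by blast
  then have "disjoint_letters (take i \<beta> @ nonempty ss @ ys)"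
    using \<beta>' by (metis append_assoc)
  then have "disjoint_letters (nonempty (take i \<beta> @ nonempty ss @ ys))"
    by (simp only: disjoint_letters_nonempty)
  also have "nonempty (take i \<beta> @ nonempty ss @ ys) = nonempty (take i \<beta> @ ss @ ys)"
    by simp
  finally show "disjoint_letters (take i \<beta> @ ss @ ys)"
    by (simp only: disjoint_letters_nonempty)
qed

text \<open>The component with the letter n + 1 is unique, and cutting it at this letter recovers
  its words. These data give back i, A and \<beta>; then p is the number of distinct letters of
  \<beta>, and undoing the shift yields \<gamma>.\<close>

lemma inj_on_build: "r \<ge> 1 \<Longrightarrow> inj_on (build r n) (pieces r n k)"
proof (rule inj_onI)
  fix x x' assume r: "r \<ge> 1" and x: "x \<in> pieces r n k" and x': "x' \<in> pieces r n k"
    and eq: "build r n x = build r n x'"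
  obtain i A p \<beta> \<gamma> where xe: "x = (i, A, p, \<beta>, \<gamma>)" by (metis prod.exhaust)
  obtain i' A' p' \<beta>' \<gamma>' where xe': "x' = (i', A', p', \<beta>', \<gamma>')" by (metis prod.exhaust)
  let ?ss = "fill_slots r A (drop i \<beta>)" and ?ss' = "fill_slots r A' (drop i' \<beta>')"
  note P = build_properties[OF r x[unfolded xe]] and P' = build_properties[OF r x'[unfolded xe']]
  have w: "Suc n \<in> set (join (Suc n) ?ss)" "Suc n \<in> set (join (Suc n) ?ss')"
    using r by (auto simp: set_join)
  have "take i \<beta> @ join (Suc n) ?ss # map (map ((+) p)) \<gamma> = take i' \<beta>' @ join (Suc n) ?ss' # map (map ((+) p')) \<gamma>'"
    using eq P(1) P'(1) xe xe' by simp
  moreover have "Suc n \<notin> set (concat (take i \<beta> @ ?ss @ map (map ((+) p)) \<gamma>))"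
    "Suc n \<notin> set (concat (take i' \<beta>' @ ?ss' @ map (map ((+) p')) \<gamma>'))"
    using P(6) P'(6) by blast+
  then have N: "Suc n \<notin> set (concat (take i \<beta>))" "Suc n \<notin> set (concat (map (map ((+) p)) \<gamma>))"
      "Suc n \<notin> set (concat (take i' \<beta>'))" "Suc n \<notin> set (concat (map (map ((+) p')) \<gamma>'))"
    and Nss: "Suc n \<notin> set (concat ?ss)" "Suc n \<notin> set (concat ?ss')"
    unfolding concat_append set_append Un_iff by blast+
  ultimately have take: "take i \<beta> = take i' \<beta>'" and j: "join (Suc n) ?ss = join (Suc n) ?ss'"
    and g: "map (map ((+) p)) \<gamma> = map (map ((+) p')) \<gamma>'"
    using max_component_unique[OF _ w(1) N(1,2) w(2) N(3,4)] by metis+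
  have "?ss \<noteq> []" "?ss' \<noteq> []"
    by (metis length_fill_slots list.size(3) nat.distinct(1))+
  then have ss: "?ss = ?ss'" using j Nss split_at_join by metis
  have "i = i'" using P(2) P'(2) take by metis
  moreover have "A = A'" using P(3) P'(3) ss by simp
  moreover have \<beta>: "\<beta> = \<beta>'"
    using P(4) P'(4) ss take by (metis append_take_drop_id)
  moreover have p: "p = p'"
    using P(5) P'(5) \<beta> by (metis card_atLeastAtMost diff_Suc_1)
  moreover have "\<gamma> = \<gamma>'"
    using g unfolding p by (simp add: inj_map_eq_map inj_mapI)
  ultimately show "x = x'" using xe xe' by simp
qed

lemma build_surj:
  assumes r: "r \<ge> 1" and \<alpha>: "\<alpha> \<in> sortable_tuples r (Suc n) (Suc k)"
  shows "\<alpha> \<in> build r n ` pieces r n k"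
proof -
  from \<alpha> have len: "length \<alpha> = Suc k" and s: "sortable_on r ([1..<n + 1] @ [Suc n]) \<alpha>"
    by (simp_all add: mem_sortable_tuples_iff)
  have "Suc n \<in> set (concat \<alpha>)"
    unfolding sortable_on_set[OF s] by simp
  then obtain w where "w \<in> set \<alpha>" and w: "Suc n \<in> set w" by auto
  then obtain xs ys where \<alpha>_eq: "\<alpha> = xs @ w # ys" by (meson split_list)
  \<comment> \<open>Components have disjoint letters, so all r copies of the largest letter lie in
    \<open>w\<close>.\<close>
  have m: "Suc n \<notin> set (concat (xs @ ys))"
    using s w unfolding sortable_on_def \<alpha>_eq by (auto simp: sorted_wrt_append)
  define ss where "ss = split_at (Suc n) w"
  have join: "join (Suc n) ss = w" by (simp add: ss_def join_split_at)
  have "count_list w (Suc n) = r"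
    using s m unfolding sortable_on_def \<alpha>_eq by (simp add: count_notin)
  then have lss: "length ss = Suc r" by (simp add: ss_def length_split_at)
  have "Suc n \<notin> set (concat ss)"
    using split_at_subset[of _ "Suc n" w] by (fastforce simp: ss_def)
  then have "Suc n \<notin> set (concat (xs @ ss @ ys))" using m by simp
  from sortable_on_join[OF lss r this, THEN iffD1, OF _ _ s[unfolded \<alpha>_eq, folded join]]
  obtain l1 l2 where l: "[1..<n + 1] = l1 @ l2" and l1: "sortable_on r l1 (xs @ nonempty ss)" and l2: "sortable_on r l2 ys"
    by (auto simp del: upt_Suc)
  define p where "p = length l1"
  have p: "p \<le> n" using arg_cong[OF l, of length] by (simp add: p_def del: upt_Suc)
  have l1_eq: "l1 = [1..<p + 1]" and l2_eq: "l2 = [p + 1..<n + 1]"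
    using arg_cong[OF l, of "take p"] arg_cong[OF l, of "drop p"] p
    by (simp_all add: p_def take_upt del: upt_Suc)
  \<comment> \<open>The truncated subtraction is exact, because all letters of \<open>ys\<close>
    exceed \<open>p\<close>.\<close>
  define \<gamma> where "\<gamma> = map (map (\<lambda>a. a - p)) ys"
  have "p < a" if "a \<in> set (concat ys)" for a
    using that unfolding sortable_on_set[OF l2] l2_eq by auto
  then have ys: "ys = map (map ((+) p)) \<gamma>"
    unfolding \<gamma>_def map_map comp_def by (intro map_idI[symmetric]) (fastforce intro!: map_idI)
  have "sortable_on r [1..<n - p + 1] \<gamma>"
    using l2 sortable_on_map[OF strict_mono_plus, of r p "[1..<n - p + 1]" \<gamma>]
    unfolding map_plus_upt[OF p] l2_eq ys by blast
  then have "\<gamma> \<in> sortable_tuples r (n - p) (k - length xs)"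
    using len unfolding mem_sortable_tuples_iff \<alpha>_eq ys by simp
  moreover have "xs @ nonempty ss \<in> sortable_tuples r p (length xs + card (slots ss))"
    using l1 unfolding mem_sortable_tuples_iff l1_eq card_slots by simp
  moreover have "slots ss \<subseteq> {..r}" using lss by (auto simp: slots_def)
  ultimately have "(length xs, slots ss, p, xs @ nonempty ss, \<gamma>) \<in> pieces r n k"
    using p len by (simp add: pieces_def \<alpha>_eq)
  moreover have "build r n (length xs, slots ss, p, xs @ nonempty ss, \<gamma>) = \<alpha>"
    by (simp add: build_def fill_slots_slots[OF lss] join \<alpha>_eq ys)
  ultimately show ?thesis by (metis imageI)
qed

lemma bij_betw_build:
  assumes "r \<ge> 1"
  shows "bij_betw (build r n) (pieces r n k) (sortable_tuples r (Suc n) (Suc k))"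
  unfolding bij_betw_def
proof (intro conjI inj_on_build[OF assms] equalityI subsetI)
  fix \<alpha> assume "\<alpha> \<in> build r n ` pieces r n k"
  then obtain i A p \<beta> \<gamma> where "\<alpha> = build r n (i, A, p, \<beta>, \<gamma>)" "(i, A, p, \<beta>, \<gamma>) \<in> pieces r n k"
    by auto
  then show "\<alpha> \<in> sortable_tuples r (Suc n) (Suc k)"
    using build_properties(8)[OF assms] by blast
qed (rule build_surj[OF assms])

lemma weight_build:
  assumes r: "r \<ge> 1" and x: "(i, A, p, \<beta>, \<gamma>) \<in> pieces r n k"
  shows "weight r (build r n (i, A, p, \<beta>, \<gamma>)) = (\<Prod>a\<in>A. mvar a) * weight r \<beta> * weight r \<gamma>"
proof -
  note P = build_properties[OF r x]
  show ?thesis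
    unfolding P(1) weight_join[OF P(6,7) length_fill_slots r] P(3,4) append_take_drop_id
      weight_map[OF strict_mono_plus] ..
qed

lemma sum_nested_Sigma:
  assumes "finite I" "finite J" "finite P" "\<And>i a p. finite (S i a p)" "\<And>i p. finite (T i p)"
  shows "(\<Sum>(i, a, p, b, c)\<in>(SIGMA i:I. SIGMA a:J. SIGMA p:P. S i a p \<times> T i p). f i a p b c) =
    (\<Sum>i\<in>I. \<Sum>a\<in>J. \<Sum>p\<in>P. \<Sum>b\<in>S i a p. \<Sum>c\<in>T i p. f i a p b c)"
proof -
  have 1: "finite (S i a p \<times> T i p)" for i a p
    using assms by blast
  have 2: "finite (SIGMA p:P. S i a p \<times> T i p)" for i a
    by (rule finite_SigmaI[OF assms(3) 1])
  have 3: "finite (SIGMA a:J. SIGMA p:P. S i a p \<times> T i p)" for i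
    by (rule finite_SigmaI[OF assms(2) 2])
  show ?thesis
    by (rule sum.Sigma[OF assms(1) ballI[OF 3], symmetric, THEN trans], rule sum.cong[OF refl],
        rule sum.Sigma[OF assms(2) ballI[OF 2], symmetric, THEN trans], rule sum.cong[OF refl],
        rule sum.Sigma[OF assms(3) ballI[OF 1], symmetric, THEN trans], rule sum.cong[OF refl],
        rule sum.cartesian_product[symmetric])
qed

text \<open>The bijection turns the sum over tuples into a sum over pieces, on which the weight
  factors. The sums over \<beta> and \<gamma> become the polynomials of the two blocks.\<close>

lemma g_poly_Suc_Suc:
  assumes r: "r \<ge> 1"
  shows "g_poly r (Suc n) (Suc k) =
    (\<Sum>i\<le>k. \<Sum>j\<le>r + 1. \<Sum>p\<le>n. elem_sym r j * g_poly r p (i + j) * g_poly r (n - p) (k - i))"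
proof -
  let ?m = "\<lambda>A. \<Prod>a\<in>A. mvar a"
  have "g_poly r (Suc n) (Suc k) = (\<Sum>x\<in>pieces r n k. weight r (build r n x))"
    unfolding g_poly_def by (rule sum.reindex_bij_betw[OF bij_betw_build[OF r], symmetric])
  also have "\<dots> = (\<Sum>(i, A, p, \<beta>, \<gamma>)\<in>pieces r n k. ?m A * weight r \<beta> * weight r \<gamma>)"
    by (intro sum.cong refl) (auto simp: weight_build[OF r])
  also have "\<dots> = (\<Sum>i\<le>k. \<Sum>A\<in>Pow {..r}. \<Sum>p\<le>n.
      \<Sum>\<beta>\<in>sortable_tuples r p (i + card A). \<Sum>\<gamma>\<in>sortable_tuples r (n - p) (k - i). ?m A * weight r \<beta> * weight r \<gamma>)"
    unfolding pieces_def by (rule sum_nested_Sigma) (simp_all add: finite_sortable_tuples)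
  also have "\<dots> = (\<Sum>i\<le>k. \<Sum>A\<in>Pow {..r}. \<Sum>p\<le>n. ?m A * g_poly r p (i + card A) * g_poly r (n - p) (k - i))"
  proof -
    have "(\<Sum>\<beta>\<in>S. \<Sum>\<gamma>\<in>T. c * weight r \<beta> * weight r \<gamma>) = c * sum (weight r) S * sum (weight r) T" for S T c
      by (simp only: mult.assoc sum_product) (simp only: sum_distrib_left)
    then show ?thesis by (simp only: g_poly_def)
  qed
  \<comment> \<open>Apart from its monomial, a term depends on \<open>A\<close> only through the
    size, so grouping by size produces \<open>elem_sym\<close>. Subsets of \<open>{..r}\<close> have
    at most r + 1 elements.\<close>
  also have "\<dots> = (\<Sum>i\<le>k. \<Sum>j\<le>r + 1. \<Sum>A | A \<in> Pow {..r} \<and> card A = j.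
      \<Sum>p\<le>n. ?m A * g_poly r p (i + card A) * g_poly r (n - p) (k - i))"
  proof (intro sum.cong refl sum.group[symmetric])
    show "card ` Pow {..r} \<subseteq> {..r + 1}"
      using card_mono[of "{..r}"] by fastforce
  qed auto
  also have "\<dots> = (\<Sum>i\<le>k. \<Sum>j\<le>r + 1. \<Sum>A | A \<in> Pow {..r} \<and> card A = j.
      \<Sum>p\<le>n. ?m A * g_poly r p (i + j) * g_poly r (n - p) (k - i))"
    by (intro sum.cong refl) auto
  also have "\<dots> = (\<Sum>i\<le>k. \<Sum>j\<le>r + 1. \<Sum>p\<le>n. elem_sym r j * g_poly r p (i + j) * g_poly r (n - p) (k - i))"
    unfolding elem_sym_def Pow_iff sum_distrib_right by (intro sum.cong refl sum.swap)
  finally show ?thesis .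
qed

lemma g_poly_0: "g_poly r 0 k = (if k = 0 then 1 else 0)"
proof -
  have "sortable_tuples r 0 k = (if k = 0 then {[]} else {})"
  proof -
    have "\<alpha> \<in> sortable_tuples r 0 k \<longleftrightarrow> k = 0 \<and> \<alpha> = []" for \<alpha>
    proof
      assume "\<alpha> \<in> sortable_tuples r 0 k"
      then have l: "length \<alpha> = k" and s: "sortable_on r [] \<alpha>"
        by (simp_all add: mem_sortable_tuples_iff)
      from sortable_on_set[OF s] s have "\<alpha> = []"
        by (cases \<alpha>) (auto simp: sortable_on_def)
      then show "k = 0 \<and> \<alpha> = []" using l by simp
    qed (simp add: mem_sortable_tuples_iff sortable_on_def)
    then show ?thesis by auto
  qed
  then show ?thesis
    by (simp add: g_poly_def weight_def tuple_descents_def)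
qed

lemma g_poly_Suc_0: "g_poly r (Suc n) 0 = 0"
proof -
  have "sortable_tuples r (Suc n) 0 = {}"
    by (auto simp: mem_sortable_tuples_iff sortable_on_def)
  then show ?thesis by (simp add: g_poly_def)
qed

section \<open>Power series\<close>

definition mdeg :: "(nat \<Rightarrow>\<^sub>0 nat) \<Rightarrow> nat" where
  "mdeg m = Sum_any (Poly_Mapping.lookup m)"

lemma mdeg_0 [simp]: "mdeg 0 = 0"
  by (simp add: mdeg_def)

lemma mdeg_add [simp]: "mdeg (a + b) = mdeg a + mdeg b"
  by (simp add: mdeg_def lookup_add Sum_any.distrib)

lemma mdeg_single [simp]: "mdeg (Poly_Mapping.single i c) = c"
proof -
  have "mdeg (Poly_Mapping.single i c) = (\<Sum>j\<in>{i}. Poly_Mapping.lookup (Poly_Mapping.single i c) j)"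
    unfolding mdeg_def by (rule Sum_any.expand_superset) (auto simp: lookup_single when_def)
  then show ?thesis by simp
qed

text \<open>Degree and admissible variables are tracked together. The zero polynomial is homogeneous
  of every degree, which makes the truncated n - k harmless for n < k.\<close>

definition homogeneous :: "nat \<Rightarrow> nat \<Rightarrow> int_mpoly \<Rightarrow> bool" where
  "homogeneous r d p \<longleftrightarrow> (\<forall>m\<in>Poly_Mapping.keys p. Poly_Mapping.keys m \<subseteq> {..r} \<and> mdeg m = d)"

lemma homogeneous_0 [simp]: "homogeneous r d 0"
  by (simp add: homogeneous_def)

lemma homogeneous_1 [simp]: "homogeneous r 0 1"
  by (simp add: homogeneous_def)

lemma homogeneous_add: "homogeneous r d p \<Longrightarrow> homogeneous r d q \<Longrightarrow> homogeneous r d (p + q)"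
  using Poly_Mapping.keys_add[of p q] unfolding homogeneous_def by blast

lemma homogeneous_sum: "(\<And>x. x \<in> A \<Longrightarrow> homogeneous r d (f x)) \<Longrightarrow> homogeneous r d (sum f A)"
  by (induction A rule: infinite_finite_induct) (auto intro: homogeneous_add)

lemma homogeneous_mult:
  assumes "homogeneous r d p" "homogeneous r e q"
  shows "homogeneous r (d + e) (p * q)"
  unfolding homogeneous_def
proof
  fix m assume "m \<in> Poly_Mapping.keys (p * q)"
  then obtain a b where m: "m = a + b" "a \<in> Poly_Mapping.keys p" "b \<in> Poly_Mapping.keys q"
    using keys_mult[of p q] by blast
  then show "Poly_Mapping.keys m \<subseteq> {..r} \<and> mdeg m = d + e"
    using assms Poly_Mapping.keys_add[of a b] unfolding homogeneous_def by fastforce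
qed

lemma homogeneous_prod_mvar:
  assumes "A \<subseteq> {..r}"
  shows "homogeneous r (card A) (\<Prod>i\<in>A. mvar i)"
proof -
  have "finite A" using assms finite_subset by blast
  then show ?thesis using assms
  proof (induction A)
    case (insert i A)
    have "homogeneous r 1 (mvar i)"
      using insert.prems by (simp add: homogeneous_def mvar_def)
    from homogeneous_mult[OF this, of "card A"] insert show ?case by simp
  qed simp
qed

lemma homogeneous_elem_sym: "homogeneous r j (elem_sym r j)"
  unfolding elem_sym_def by (rule homogeneous_sum) (use homogeneous_prod_mvar in blast)

text \<open>In a nonzero term of the recursion the degrees j, p - (i + j) and (n - 1 - p) - (k - 1 -
  i) add up to n - k. The vanishing for n < k is proved along with this, so that terms in which a
  subtraction would be truncated drop out.\<close>

lemma g_poly_homogeneous: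
  assumes r: "r \<ge> 1"
  shows "(n < k \<longrightarrow> g_poly r n k = 0) \<and> homogeneous r (n - k) (g_poly r n k)"
proof (induction n arbitrary: k rule: less_induct)
  case (less n)
  show ?case
  proof (cases n)
    case 0
    then show ?thesis by (simp add: g_poly_0)
  next
    case n: (Suc n')
    show ?thesis
    proof (cases k)
      case 0
      then show ?thesis by (simp add: n g_poly_Suc_0)
    next
      case k: (Suc k')
      have IH: "p < q \<Longrightarrow> g_poly r p q = 0" "homogeneous r (p - q) (g_poly r p q)" if "p \<le> n'" for p q
        using less.IH[of p] that n by auto
      let ?t = "\<lambda>i j p. elem_sym r j * g_poly r p (i + j) * g_poly r (n' - p) (k' - i)"
      have zero: "?t i j p = 0" if "p < i + j \<or> n' - p < k' - i" "p \<le> n'" for i j p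
        using that IH(1)[of p "i + j"] IH(1)[of "n' - p" "k' - i"] by auto
      have "homogeneous r (n - k) (?t i j p)" if "i \<le> k'" "p \<le> n'" for i j p
      proof (cases "p < i + j \<or> n' - p < k' - i")
        case False
        have "homogeneous r (j + (p - (i + j)) + ((n' - p) - (k' - i))) (?t i j p)"
          using that by (intro homogeneous_mult homogeneous_elem_sym IH(2)) auto
        moreover have "j + (p - (i + j)) + ((n' - p) - (k' - i)) = n - k"
          using that False unfolding n k by arith
        ultimately show ?thesis by simp
      qed (simp add: zero that)
      then have "homogeneous r (n - k) (g_poly r n k)"
        unfolding n k g_poly_Suc_Suc[OF r] by (intro homogeneous_sum) auto
      \<comment> \<open>Otherwise \<open>i + j \<le> p\<close> and
        \<open>k' - i \<le> n' - p\<close>, which add up to \<open>k' + j \<le> n'\<close>, contrary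
        to \<open>n < k\<close>.\<close>
      moreover have "?t i j p = 0" if "n < k" "i \<le> k'" "p \<le> n'" for i j p
        by (rule zero) (use that n k in auto)
      then have "g_poly r n k = 0" if "n < k"
        unfolding n k g_poly_Suc_Suc[OF r] using that[unfolded n k] n k by (intro sum.neutral ballI) auto
      ultimately show ?thesis by blast
    qed
  qed
qed

lemma lookup_g_poly_neq_0D:
  assumes "r \<ge> 1" "Poly_Mapping.lookup (g_poly r n k) m \<noteq> 0"
  shows "Poly_Mapping.keys m \<subseteq> {..r}" "n = mdeg m + k"
proof -
  have "m \<in> Poly_Mapping.keys (g_poly r n k)" using assms(2) by (simp add: in_keys_iff)
  moreover have "\<not> n < k" using assms g_poly_homogeneous[of r n k] by auto
  ultimately show "Poly_Mapping.keys m \<subseteq> {..r}" "n = mdeg m + k"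
    using g_poly_homogeneous[OF assms(1), of n k] unfolding homogeneous_def by auto
qed

section \<open>Coefficients of power series\<close>

lemma mcoeff_0 [simp]: "mcoeff 0 m = 0"
  by (simp add: zero_mseries_def)

lemma mcoeff_1: "mcoeff 1 m = (if m = 0 then 1 else 0)"
  by (simp add: one_mseries_def)

lemma mcoeff_add [simp]: "mcoeff (f + g) m = mcoeff f m + mcoeff g m"
  by (simp add: plus_mseries_def)

lemma mcoeff_sum: "mcoeff (sum f A) m = (\<Sum>x\<in>A. mcoeff (f x) m)"
  by (induction A rule: infinite_finite_induct) auto

lemma mcoeff_mult: "mcoeff (f * g) m = (\<Sum>(a, b)\<in>splittings m. mcoeff f a * mcoeff g b)"
  by (simp add: times_mseries_def)

lemma mcoeff_mult_3:
  "mcoeff (e * f * g) m =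
     (\<Sum>(q, c)\<in>splittings m. \<Sum>(a, b)\<in>splittings q. mcoeff e a * mcoeff f b * mcoeff g c)"
  by (simp add: mcoeff_mult sum_distrib_right case_prod_unfold)

text \<open>This matches the product of polynomials with the convolution over
  \<open>splittings\<close>, so that \<open>series_of_poly\<close> is multiplicative.\<close>

lemma lookup_mult_splittings:
  fixes p q :: int_mpoly
  shows "Poly_Mapping.lookup (p * q) m =
    (\<Sum>(a, b)\<in>splittings m. Poly_Mapping.lookup p a * Poly_Mapping.lookup q b)"
proof -
  have "Poly_Mapping.lookup (p * q) m =
      Sum_any (\<lambda>(a, b). Poly_Mapping.lookup p a * Poly_Mapping.lookup q b when m = a + b)"
    unfolding times_poly_mapping.rep_eq by (rule prod_fun_unfold_prod) simp_all
  also have "\<dots> = (\<Sum>(a, b)\<in>splittings m. Poly_Mapping.lookup p a * Poly_Mapping.lookup q b when m = a + b)"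
    by (rule Sum_any.expand_superset[OF finite_splittings]) (auto simp: splittings_def split: if_splits)
  also have "\<dots> = (\<Sum>(a, b)\<in>splittings m. Poly_Mapping.lookup p a * Poly_Mapping.lookup q b)"
    by (intro sum.cong refl) (auto simp: splittings_def)
  finally show ?thesis .
qed

lemma mcoeff_series_of_poly [simp]: "mcoeff (series_of_poly p) m = of_int (Poly_Mapping.lookup p m)"
  by (simp add: series_of_poly_def)

lemma series_of_poly_mult: "series_of_poly (p * q) = series_of_poly p * series_of_poly q"
  by (rule mseries_eqI) (simp add: mcoeff_mult lookup_mult_splittings case_prod_unfold)

lemma series_of_poly_sum: "series_of_poly (sum f A) = (\<Sum>x\<in>A. series_of_poly (f x))"
  by (rule mseries_eqI) (simp add: mcoeff_sum Poly_Mapping.lookup_sum)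

lemma mcoeff_elem_sym: "mdeg m \<noteq> j \<Longrightarrow> mcoeff (series_of_poly (elem_sym r j)) m = 0"
  using homogeneous_elem_sym[of r j] by (auto simp: homogeneous_def in_keys_iff)

lemma summable_g_poly:
  assumes "r \<ge> 1"
  shows "mseries_summable (\<lambda>n. series_of_poly (g_poly r n k))"
  unfolding mseries_summable_def
proof
  fix m
  have "{n. mcoeff (series_of_poly (g_poly r n k)) m \<noteq> 0} \<subseteq> {mdeg m + k}"
    using lookup_g_poly_neq_0D(2)[OF assms] by auto
  then show "finite {n. mcoeff (series_of_poly (g_poly r n k)) m \<noteq> 0}"
    by (rule finite_subset) simp
qed

text \<open>By homogeneity only \<open>n = mdeg m + k\<close> contributes to the coefficient of \<open>m\<close> in \<open>g\<^sub>k\<close>.\<close>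

lemma mcoeff_g_series:
  assumes "r \<ge> 1"
  shows "mcoeff (g_series r k) m = of_int (Poly_Mapping.lookup (g_poly r (mdeg m + k) k) m)"
proof -
  have "mcoeff (g_series r k) m = (\<Sum>n\<in>{mdeg m + k}. mcoeff (series_of_poly (g_poly r n k)) m)"
    unfolding g_series_def mseries_suminf_def mcoeff_Abs
    by (rule Sum_any.expand_superset) (use lookup_g_poly_neq_0D(2)[OF assms] in auto)
  then show ?thesis by simp
qed

section \<open>The functional equation as a recursion on the coefficients\<close>

definition satisfies_recursion :: "nat \<Rightarrow> (nat \<Rightarrow> rat mseries) \<Rightarrow> bool" where
  "satisfies_recursion r h \<longleftrightarrow> h 0 = 1 \<and>
     (\<forall>k. h (Suc k) = (\<Sum>i\<le>k. \<Sum>j\<le>r + 1. series_of_poly (elem_sym r j) * h (i + j) * h (k - i)))"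

text \<open>The factor \<open>fps_X\<close> moves coefficient k of the product of
  \<open>F_of r H\<close> and \<open>H\<close> to k + 1. There i is the index taken from
  \<open>F_of r H\<close>, and j is the summation index in its definition.\<close>

lemma functional_equation_iff:
  "H = 1 + fps_X * F_of r H * H \<longleftrightarrow> satisfies_recursion r (fps_nth H)"
proof -
  have 0: "fps_nth (1 + fps_X * F_of r H * H) 0 = 1"
    by (simp add: mult.assoc)
  have Suc: "fps_nth (1 + fps_X * F_of r H * H) (Suc k) =
      (\<Sum>i\<le>k. \<Sum>j\<le>r + 1. series_of_poly (elem_sym r j) * fps_nth H (i + j) * fps_nth H (k - i))" for k
  proof -
    have "fps_nth (1 + fps_X * F_of r H * H) (Suc k) = fps_nth (F_of r H * H) k"
      by (simp add: mult.assoc)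
    also have "\<dots> = (\<Sum>i\<le>k. \<Sum>j\<le>r + 1. series_of_poly (elem_sym r j) * fps_nth H (i + j) * fps_nth H (k - i))"
      by (simp add: fps_mult_nth F_of_def sum_distrib_right atLeast0AtMost mult.commute[of "fps_nth H _" "series_of_poly _"]
          del: sum.atMost_Suc)
    finally show ?thesis .
  qed
  show ?thesis
    unfolding satisfies_recursion_def Suc[symmetric] 0[symmetric] fps_eq_iff
    by (metis not0_implies_Suc)
qed

text \<open>The polynomial recursion is compared at a single monomial m. By homogeneity a triple a +
  b + c = m with mdeg a = j leaves one value of p, and other triples contribute nothing, so the sum
  over p disappears.\<close>

lemma g_series_recursion:
  assumes r: "r \<ge> 1"
  shows "satisfies_recursion r (g_series r)"
  unfolding satisfies_recursion_def
proof (intro conjI allI)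
  show "g_series r 0 = 1"
  proof (rule mseries_eqI)
    fix m
    show "mcoeff (g_series r 0) m = mcoeff 1 m"
    proof (cases "mdeg m")
      case 0
      then show ?thesis
        by (simp add: mcoeff_g_series[OF r] g_poly_0 mcoeff_1 lookup_one when_def)
    next
      case (Suc d)
      then have "m \<noteq> 0" by auto
      then show ?thesis
        by (simp add: mcoeff_g_series[OF r] Suc g_poly_Suc_0 mcoeff_1)
    qed
  qed
next
  fix k
  show "g_series r (Suc k) =
    (\<Sum>i\<le>k. \<Sum>j\<le>r + 1. series_of_poly (elem_sym r j) * g_series r (i + j) * g_series r (k - i))"
  proof (rule mseries_eqI)
    fix m
    \<comment> \<open>Then \<open>mdeg m + Suc k = Suc n\<close>, the index at which
      \<open>g_poly_Suc_Suc\<close> applies.\<close>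
    define n where "n = mdeg m + k"
    define P where "P = (\<lambda>n k. series_of_poly (g_poly r n k))"
    let ?E = "\<lambda>j. series_of_poly (elem_sym r j)"
    have P: "mcoeff (P p q) b = (if p = mdeg b + q then mcoeff (g_series r q) b else 0)" for p q b
      using lookup_g_poly_neq_0D(2)[OF r, of p q b] by (auto simp: P_def mcoeff_g_series[OF r])
    have "mcoeff (g_series r (Suc k)) m = mcoeff (series_of_poly (g_poly r (Suc n) (Suc k))) m"
      by (simp add: mcoeff_g_series[OF r] n_def)
    also have "\<dots> = (\<Sum>i\<le>k. \<Sum>j\<le>r + 1. \<Sum>p\<le>n. mcoeff (?E j * P p (i + j) * P (n - p) (k - i)) m)"
      unfolding g_poly_Suc_Suc[OF r] series_of_poly_sum series_of_poly_mult mcoeff_sum P_def ..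
    also have "\<dots> = (\<Sum>i\<le>k. \<Sum>j\<le>r + 1. mcoeff (?E j * g_series r (i + j) * g_series r (k - i)) m)"
    proof (intro sum.cong refl)
      fix i j assume "i \<in> {..k}"
      then have i: "i \<le> k" by simp
      have "(\<Sum>p\<le>n. mcoeff (?E j) a * mcoeff (P p (i + j)) b * mcoeff (P (n - p) (k - i)) c) =
          mcoeff (?E j) a * mcoeff (g_series r (i + j)) b * mcoeff (g_series r (k - i)) c"
        if abc: "a + b + c = m" for a b c
      proof (cases "mdeg a = j")
        case True
        \<comment> \<open>The degree of the middle factor forces this index. As mdeg a = j, the
          remainder \<open>n - ?p\<close> is exactly the index at which the last factor
          contributes.\<close>
        let ?p = "mdeg b + (i + j)"
        have p: "?p \<le> n" "n - ?p = mdeg c + (k - i)"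
          using True i by (simp_all add: n_def abc[symmetric])
        have "(\<Sum>p\<le>n. mcoeff (?E j) a * mcoeff (P p (i + j)) b * mcoeff (P (n - p) (k - i)) c) =
            (\<Sum>p\<in>{?p}. mcoeff (?E j) a * mcoeff (P p (i + j)) b * mcoeff (P (n - p) (k - i)) c)"
          using p(1) by (intro sum.mono_neutral_right) (auto simp: P)
        then show ?thesis by (simp only: sum.insert_if finite.emptyI empty_iff sum.empty P p) simp
      qed (simp only: mcoeff_elem_sym mult_zero_left sum.neutral_const not_False_eq_True)
      note inner = this
      have "(\<Sum>p\<le>n. mcoeff (?E j * P p (i + j) * P (n - p) (k - i)) m) =
          (\<Sum>(q, c)\<in>splittings m. \<Sum>(a, b)\<in>splittings q.
             \<Sum>p\<le>n. mcoeff (?E j) a * mcoeff (P p (i + j)) b * mcoeff (P (n - p) (k - i)) c)"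
        unfolding mcoeff_mult_3 case_prod_unfold
        by (subst sum.swap, intro sum.cong refl, subst sum.swap, rule refl)
      also have "\<dots> = mcoeff (?E j * g_series r (i + j) * g_series r (k - i)) m"
        unfolding mcoeff_mult_3
        by (intro sum.cong refl) (auto simp: splittings_def inner intro!: sum.cong simp del: mcoeff_series_of_poly)
      finally show "(\<Sum>p\<le>n. mcoeff (?E j * P p (i + j) * P (n - p) (k - i)) m) =
          mcoeff (?E j * g_series r (i + j) * g_series r (k - i)) m" .
    qed
    finally show "mcoeff (g_series r (Suc k)) m = mcoeff (\<Sum>i\<le>k. \<Sum>j\<le>r + 1.
        ?E j * g_series r (i + j) * g_series r (k - i)) m"
      by (simp only: mcoeff_sum)
  qed
qed

text \<open>The recursion determines the coefficient of \<open>m\<close> in \<open>h\<^sub>k\<close> from coefficients with a smaller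
  value of \<open>mdeg m + k\<close>.\<close>

lemma recursion_unique:
  assumes h: "satisfies_recursion r h" and h': "satisfies_recursion r h'"
  shows "h k = h' k"
proof -
  have "mcoeff (h k) m = mcoeff (h' k) m" for m
  proof (induction "mdeg m + k" arbitrary: m k rule: less_induct)
    case (less m k)
    show ?case
    proof (cases k)
      case 0
      then show ?thesis using h h' by (simp add: satisfies_recursion_def)
    next
      case k: (Suc k')
      let ?E = "\<lambda>j. series_of_poly (elem_sym r j)"
      have "mcoeff (?E j) a * mcoeff (h (i + j)) b * mcoeff (h (k' - i)) c =
          mcoeff (?E j) a * mcoeff (h' (i + j)) b * mcoeff (h' (k' - i)) c"
        if "a + b + c = m" "i \<le> k'" for i j a b c
      proof (cases "mdeg a = j")
        case True
        \<comment> \<open>The index rises by j, but a uses up degree j: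
          \<open>mdeg b + j \<le> mdeg m\<close>, while \<open>i < k\<close>. For the last factor,
          \<open>mdeg c \<le> mdeg m\<close> and \<open>k' - i < k\<close>.\<close>
        then have "mdeg b + (i + j) < mdeg m + k" "mdeg c + (k' - i) < mdeg m + k"
          using that k by auto
        with less show ?thesis by simp
      qed (simp only: mcoeff_elem_sym mult_zero_left not_False_eq_True)
      then have "mcoeff (?E j * h (i + j) * h (k' - i)) m = mcoeff (?E j * h' (i + j) * h' (k' - i)) m"
        if "i \<le> k'" for i j
        unfolding mcoeff_mult_3 using that
        by (intro sum.cong refl) (auto simp: splittings_def intro!: sum.cong simp del: mcoeff_series_of_poly)
      then have "(\<Sum>i\<le>k'. \<Sum>j\<le>r + 1. mcoeff (?E j * h (i + j) * h (k' - i)) m) =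
          (\<Sum>i\<le>k'. \<Sum>j\<le>r + 1. mcoeff (?E j * h' (i + j) * h' (k' - i)) m)"
        by (intro sum.cong refl) auto
      then show ?thesis
        using h h' unfolding k satisfies_recursion_def by (simp only: mcoeff_sum)
    qed
  qed
  then show ?thesis by (rule mseries_eqI)
qed

theorem theorem2:
  fixes r :: nat
  assumes "r \<ge> 1"
  shows "(\<forall>k. mseries_summable (\<lambda>n. series_of_poly (g_poly r n k)))
    \<and> (\<forall>k. fps_nth (G_series r) k \<in> series_in_vars {..r})
    \<and> G_series r = 1 + fps_X * F_of r (G_series r) * G_series r
    \<and> (\<forall>H. (\<forall>k. fps_nth H k \<in> series_in_vars {..r}) \<and> H = 1 + fps_X * F_of r H * H
           \<longrightarrow> H = G_series r \<and> F_of r H = F_of r (G_series r))"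
proof -
  have rec: "satisfies_recursion r (fps_nth (G_series r))"
  proof -
    have "fps_nth (G_series r) = g_series r" by (rule ext) (simp add: G_series_def)
    then show ?thesis using g_series_recursion[OF assms] by simp
  qed
  have "H = G_series r" if "H = 1 + fps_X * F_of r H * H" for H
    using recursion_unique[OF that[unfolded functional_equation_iff] rec] by (simp add: fps_eq_iff)
  moreover have "fps_nth (G_series r) k \<in> series_in_vars {..r}" for k
    using lookup_g_poly_neq_0D(1)[OF assms]
    by (auto simp: series_in_vars_def G_series_def mcoeff_g_series[OF assms])
  ultimately show ?thesis
    using summable_g_poly[OF assms] rec[folded functional_equation_iff] by blast
qed

end
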